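(* Let $D=S(V)$ be the commutative algebra generated by the couples $(t,s)$, where $t$ is a rooted tree and $s=P^{c_0}(t)$ for some admissible cut $c_0$ of $t$, with product $(t,s)(t',s')=(tt',ss')$. Let $\Delta:D\to D\otimes D$ be given by $$\Delta(t,s)=\sum_{c\in \mathrm{Adm}(s)}\big(t,P^c(s)\big)\otimes\big(R^c(t),R^c(s)\big).$$ Then $D$, with this product, the coproduct $\Delta$, the unit $\mathbf 1$ identified with the empty forest, the counit $\varepsilon(t,s)=\varepsilon(s)$, and the grading $|(t,s)|=|s|$ (the number of vertices of $s$), is a graded bialgebra.
   Context: Work over a fixed base field. A rooted tree is a finite connected simply connected oriented graph in which every vertex has exactly one incoming edge, except a distinguished vertex (the root) which has none; a rooted forest is a finite (possibly empty) disjoint union of rooted trees; trees and forests are taken up to isomorphism. The product of forests is disjoint union (concatenation) and $\mathbf 1$ denotes the empty forest. Admissible cuts: an admissible cut $c$ of a rooted tree $t$ is a (possibly empty) set of edges such that every path from the root to a leaf contains at most one edge of $c$; in addition one allows the total cut. The pruning $P^c(t)$ is the subforest of $t$ lying above the cut and the trunk $R^c(t)$ is the subtree lying below it (containing the root). For the empty cut $P^c(t)=\mathbf 1$, $R^c(t)=t$; for the total cut $P^c(t)=t$, $R^c(t)=\mathbf 1$. An admissible cut of a forest is a choice of an admissible cut (possibly empty or total) of each component, and $P^c,R^c$ are the corresponding products. $\mathrm{Adm}(t)$ denotes the set of all admissible cuts (including empty and total ones). $V$ is the vector space spanned by couples $(t,s)$ with $t$ a rooted tree (the couple $(\mathbf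 1,\mathbf 1)$ of empty forests is allowed and is identified with the unit of $D$) and $s=P^{c_0}(t)$, $c_0\in\mathrm{Adm}(t)$. Here $s$ is remembered as a subforest of $t$, and couples are taken up to isomorphism of couples. If $s=P^{c_0}(t)$ and $c\in\mathrm{Adm}(s)$, then $P^c(s)$ is also a pruning of $t$, and $R^c(t)$ denotes the corresponding trunk, i.e. the subtree of $t$ on the vertices not in $P^c(s)$. $\Delta$ is extended to $D$ by the same formula for products of such couples (multiplicatively). The counit on forests is $\varepsilon(\mathbf 1)=1$ and $\varepsilon(s)=0$ for every nonempty forest $s$; on $D$ it is extended multiplicatively. *)

theory Defs
  imports
    "Graph_Theory.Graph_Theory"
    "HOL-Library.Multiset"
    "HOL-Library.FuncSet"
    "HOL-Library.Poly_Mapping"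
    "HOL-Library.Product_Plus"
begin

section \<open>Tensor products of vector spaces with a basis\<close>

text \<open>
  The type \<^typ>\<open>'a \<Rightarrow>\<^sub>0 'k\<close> is the vector space with basis indexed by \<^typ>\<open>'a\<close>, the basis vectors being
  \<^term>\<open>Poly_Mapping.single i 1\<close>. The tensor product of the spaces with bases \<^typ>\<open>'a\<close> and \<^typ>\<open>'b\<close>
  is the space with basis \<^typ>\<open>'a \<times> 'b\<close>; the lemmas on \<open>tensor\<close> and \<open>tensor_lift\<close> below
  state its universal property.
\<close>

definition pm_scale :: "'k::field \<Rightarrow> ('a \<Rightarrow>\<^sub>0 'k) \<Rightarrow> ('a \<Rightarrow>\<^sub>0 'k)" where
  "pm_scale c = Poly_Mapping.map ((*) c)"

definition lin_ext :: "('k::field \<Rightarrow> 'v \<Rightarrow> 'v::comm_monoid_add) \<Rightarrow> ('a \<Rightarrow> 'v) \<Rightarrow> ('a \<Rightarrow>\<^sub>0 'k) \<Rightarrow> 'v" where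
  "lin_ext scale f x = (\<Sum>i\<in>Poly_Mapping.keys x. scale (Poly_Mapping.lookup x i) (f i))"

definition tensor :: "('a \<Rightarrow>\<^sub>0 'k::field) \<Rightarrow> ('b \<Rightarrow>\<^sub>0 'k) \<Rightarrow> ('a \<times> 'b \<Rightarrow>\<^sub>0 'k)" where
  "tensor x y = (\<Sum>i\<in>Poly_Mapping.keys x. \<Sum>j\<in>Poly_Mapping.keys y.
     Poly_Mapping.single (i, j) (Poly_Mapping.lookup x i * Poly_Mapping.lookup y j))"

text \<open>The linear map on the tensor product induced by a bilinear map \<open>B\<close>.\<close>

definition tensor_lift ::
  "(('a \<Rightarrow>\<^sub>0 'k::field) \<Rightarrow> ('b \<Rightarrow>\<^sub>0 'k) \<Rightarrow> ('c \<Rightarrow>\<^sub>0 'k)) \<Rightarrow> ('a \<times> 'b \<Rightarrow>\<^sub>0 'k) \<Rightarrow> ('c \<Rightarrow>\<^sub>0 'k)" where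
  "tensor_lift B = lin_ext pm_scale (\<lambda>(i, j). B (Poly_Mapping.single i 1) (Poly_Mapping.single j 1))"

definition bilinear_pm ::
  "(('a \<Rightarrow>\<^sub>0 'k::field) \<Rightarrow> ('b \<Rightarrow>\<^sub>0 'k) \<Rightarrow> ('c \<Rightarrow>\<^sub>0 'k)) \<Rightarrow> bool" where
  "bilinear_pm B \<longleftrightarrow> (\<forall>x. Vector_Spaces.linear pm_scale pm_scale (B x)) \<and>
     (\<forall>y. Vector_Spaces.linear pm_scale pm_scale (\<lambda>x. B x y))"

definition tensor_map ::
  "(('a \<Rightarrow>\<^sub>0 'k::field) \<Rightarrow> ('c \<Rightarrow>\<^sub>0 'k)) \<Rightarrow> (('b \<Rightarrow>\<^sub>0 'k) \<Rightarrow> ('d \<Rightarrow>\<^sub>0 'k)) \<Rightarrow>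
     ('a \<times> 'b \<Rightarrow>\<^sub>0 'k) \<Rightarrow> ('c \<times> 'd \<Rightarrow>\<^sub>0 'k)" where
  "tensor_map f g = tensor_lift (\<lambda>x y. tensor (f x) (g y))"

definition tensor_assoc :: "(('a \<times> 'b) \<times> 'c \<Rightarrow>\<^sub>0 'k::field) \<Rightarrow> ('a \<times> 'b \<times> 'c \<Rightarrow>\<^sub>0 'k)" where
  "tensor_assoc = tensor_lift (\<lambda>u z. tensor_lift (\<lambda>x y. tensor x (tensor y z)) u)"

text \<open>The product \<open>(x \<otimes> y)(x' \<otimes> y') = xx' \<otimes> yy'\<close>.\<close>

definition tensor_mul ::
  "(('a \<Rightarrow>\<^sub>0 'k::field) \<Rightarrow> ('a \<Rightarrow>\<^sub>0 'k) \<Rightarrow> ('a \<Rightarrow>\<^sub>0 'k)) \<Rightarrow>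
     ('a \<times> 'a \<Rightarrow>\<^sub>0 'k) \<Rightarrow> ('a \<times> 'a \<Rightarrow>\<^sub>0 'k) \<Rightarrow> ('a \<times> 'a \<Rightarrow>\<^sub>0 'k)" where
  "tensor_mul mul u v =
     tensor_lift (\<lambda>x y. tensor_lift (\<lambda>x' y'. tensor (mul x x') (mul y y')) v) u"

lemma lookup_pm_scale [simp]:
  "Poly_Mapping.lookup (pm_scale c x) i = c * Poly_Mapping.lookup x i"
  by (simp add: pm_scale_def Poly_Mapping.map.rep_eq when_def)

lemma vector_space_pm_scale: "vector_space (pm_scale :: 'k::field \<Rightarrow> ('a \<Rightarrow>\<^sub>0 'k) \<Rightarrow> _)"
  by unfold_locales
    (auto intro!: poly_mapping_eqI simp: lookup_add distrib_left distrib_right)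

lemma pm_scale_single [simp]:
  "pm_scale c (Poly_Mapping.single i d) = Poly_Mapping.single i (c * d)"
  by (auto intro!: poly_mapping_eqI simp: lookup_single when_def)

lemma sum_monomials:
  "(\<Sum>i\<in>Poly_Mapping.keys x. Poly_Mapping.single i (Poly_Mapping.lookup x i)) = x"
  by (rule poly_mapping_eqI) (auto simp: lookup_sum lookup_single when_def in_keys_iff)

lemma sum_scaled_basis:
  "(\<Sum>i\<in>Poly_Mapping.keys x. pm_scale (Poly_Mapping.lookup x i) (Poly_Mapping.single i 1)) = x"
  by (simp add: sum_monomials)

lemma pm_induct [case_names single add]:
  fixes x :: "'a \<Rightarrow>\<^sub>0 'b::comm_monoid_add"
  assumes single: "\<And>i c. P (Poly_Mapping.single i c)" and add: "\<And>x y. P x \<Longrightarrow> P y \<Longrightarrow> P (x + y)"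
  shows "P x"
proof -
  have "P (\<Sum>i\<in>A. Poly_Mapping.single i (f i))" if "finite A" for A f
    using that
  proof (induction A)
    case empty
    then show ?case using single[of undefined 0] by simp
  qed (simp add: single add)
  from this[OF finite_keys, of "Poly_Mapping.lookup x" x] show ?thesis
    by (simp add: sum_monomials)
qed

lemma linear_pm_sum:
  assumes "Vector_Spaces.linear pm_scale pm_scale f"
  shows "f (sum g A) = (\<Sum>i\<in>A. f (g i))"
proof -
  interpret Vector_Spaces.linear pm_scale pm_scale f by fact
  show ?thesis by (rule sum)
qed

lemma linear_pm_scale:
  assumes "Vector_Spaces.linear pm_scale pm_scale f"
  shows "f (pm_scale c x) = pm_scale c (f x)"
proof -
  interpret Vector_Spaces.linear pm_scale pm_scale f by fact
  show ?thesis by (rule scale)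
qed

lemma linear_lin_ext:
  fixes f :: "'a \<Rightarrow> ('c \<Rightarrow>\<^sub>0 'k::field)"
  shows "Vector_Spaces.linear pm_scale pm_scale (lin_ext pm_scale f)"
proof -
  interpret vector_space "pm_scale :: 'k \<Rightarrow> ('c \<Rightarrow>\<^sub>0 'k) \<Rightarrow> _" by (rule vector_space_pm_scale)
  have ext: "lin_ext pm_scale f x = (\<Sum>i\<in>A. pm_scale (Poly_Mapping.lookup x i) (f i))"
    if "finite A" "Poly_Mapping.keys x \<subseteq> A" for x A
    unfolding lin_ext_def using that
    by (intro sum.mono_neutral_left) (auto simp: in_keys_iff)
  show ?thesis
    unfolding Vector_Spaces.linear_iff
  proof (intro conjI allI vector_space_pm_scale)
    fix x y :: "'a \<Rightarrow>\<^sub>0 'k"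
    let ?A = "Poly_Mapping.keys x \<union> Poly_Mapping.keys y"
    show "lin_ext pm_scale f (x + y) = lin_ext pm_scale f x + lin_ext pm_scale f y"
      using keys_add[of x y]
      by (simp add: ext[of ?A] lookup_add scale_left_distrib sum.distrib)
  next
    fix c :: 'k and x :: "'a \<Rightarrow>\<^sub>0 'k"
    have "Poly_Mapping.keys (pm_scale c x) \<subseteq> Poly_Mapping.keys x"
      by (auto simp: in_keys_iff)
    then show "lin_ext pm_scale f (pm_scale c x) = pm_scale c (lin_ext pm_scale f x)"
      by (simp add: ext[of "Poly_Mapping.keys x"] scale_sum_right)
  qed
qed

lemma lookup_tensor [simp]:
  "Poly_Mapping.lookup (tensor x y) (i, j) = Poly_Mapping.lookup x i * Poly_Mapping.lookup y j"
proof -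
  have "Poly_Mapping.lookup (tensor x y) (i, j) =
      (\<Sum>i'\<in>Poly_Mapping.keys x. \<Sum>j'\<in>Poly_Mapping.keys y.
        if i' = i then (if j' = j then Poly_Mapping.lookup x i' * Poly_Mapping.lookup y j' else 0) else 0)"
    unfolding tensor_def lookup_sum
    by (intro sum.cong refl) (auto simp: lookup_single when_def)
  also have "\<dots> = (\<Sum>i'\<in>Poly_Mapping.keys x. if i' = i then
       (\<Sum>j'\<in>Poly_Mapping.keys y. if j' = j then Poly_Mapping.lookup x i' * Poly_Mapping.lookup y j' else 0) else 0)"
    by (intro sum.cong refl) auto
  finally show ?thesis by (auto simp: in_keys_iff)
qed

lemma bilinear_tensor: "bilinear_pm (tensor :: ('a \<Rightarrow>\<^sub>0 'k::field) \<Rightarrow> ('b \<Rightarrow>\<^sub>0 'k) \<Rightarrow> _)"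
  unfolding bilinear_pm_def Vector_Spaces.linear_iff
  by (auto intro!: poly_mapping_eqI vector_space_pm_scale simp: lookup_add algebra_simps)

lemma linear_tensor_lift: "Vector_Spaces.linear pm_scale pm_scale (tensor_lift B)"
  unfolding tensor_lift_def by (rule linear_lin_ext)

lemma tensor_single: "tensor (Poly_Mapping.single i c) (Poly_Mapping.single j d) =
    Poly_Mapping.single (i, j) (c * d)"
  by (rule poly_mapping_eqI) (auto simp: lookup_single when_def split: if_splits)

lemma tensor_lift_tensor:
  assumes "bilinear_pm B"
  shows "tensor_lift B (tensor x y) = B x y"
proof -
  have lin1: "\<And>y. Vector_Spaces.linear pm_scale pm_scale (\<lambda>x. B x y)"
    and lin2: "\<And>x. Vector_Spaces.linear pm_scale pm_scale (B x)"
    using assms by (auto simp: bilinear_pm_def)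
  have 1: "B x y = (\<Sum>i\<in>Poly_Mapping.keys x. \<Sum>j\<in>Poly_Mapping.keys y.
      pm_scale (Poly_Mapping.lookup x i) (pm_scale (Poly_Mapping.lookup y j)
        (B (Poly_Mapping.single i 1) (Poly_Mapping.single j 1))))"
  proof -
    interpret vector_space pm_scale by (rule vector_space_pm_scale)
    have "B x y = B (\<Sum>i\<in>Poly_Mapping.keys x. pm_scale (Poly_Mapping.lookup x i) (Poly_Mapping.single i 1)) y"
      by (simp only: sum_scaled_basis)
    also have "\<dots> = (\<Sum>i\<in>Poly_Mapping.keys x. pm_scale (Poly_Mapping.lookup x i) (B (Poly_Mapping.single i 1) y))"
      by (simp only: linear_pm_sum[OF lin1] linear_pm_scale[OF lin1])
    also have "\<dots> = (\<Sum>i\<in>Poly_Mapping.keys x. pm_scale (Poly_Mapping.lookup x i)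
        (\<Sum>j\<in>Poly_Mapping.keys y. pm_scale (Poly_Mapping.lookup y j)
          (B (Poly_Mapping.single i 1) (Poly_Mapping.single j 1))))"
    proof (intro sum.cong refl arg_cong[of _ _ "pm_scale _"])
      fix i
      have "B (Poly_Mapping.single i 1) y = B (Poly_Mapping.single i 1)
         (\<Sum>j\<in>Poly_Mapping.keys y. pm_scale (Poly_Mapping.lookup y j) (Poly_Mapping.single j 1))"
        by (simp only: sum_scaled_basis)
      also have "\<dots> = (\<Sum>j\<in>Poly_Mapping.keys y. pm_scale (Poly_Mapping.lookup y j)
          (B (Poly_Mapping.single i 1) (Poly_Mapping.single j 1)))"
        by (simp only: linear_pm_sum[OF lin2] linear_pm_scale[OF lin2])
      finally show "B (Poly_Mapping.single i 1) y = \<dots>" .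
    qed
    finally show ?thesis by (simp add: scale_sum_right)
  qed
  have 2: "tensor_lift B (tensor x y) = (\<Sum>i\<in>Poly_Mapping.keys x. \<Sum>j\<in>Poly_Mapping.keys y.
      tensor_lift B (Poly_Mapping.single (i, j) (Poly_Mapping.lookup x i * Poly_Mapping.lookup y j)))"
    unfolding tensor_def
    by (simp add: linear_pm_sum[OF linear_tensor_lift])
  interpret vector_space pm_scale by (rule vector_space_pm_scale)
  show ?thesis unfolding 1 2
    by (intro sum.cong refl) (auto simp: tensor_lift_def lin_ext_def)
qed

lemma tensor_add_left: "tensor (x + x') y = tensor x y + tensor x' y"
  and tensor_add_right: "tensor x (y + y') = tensor x y + tensor x y'"
  by (auto intro!: poly_mapping_eqI simp: lookup_add algebra_simps)

lemma tensor_mult: "tensor x y * tensor x' y' = tensor (x * x') (y * y')"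
  for x x' :: "'a::comm_monoid_add \<Rightarrow>\<^sub>0 'k::field" and y y' :: "'b::comm_monoid_add \<Rightarrow>\<^sub>0 'k"
proof (induction x rule: pm_induct)
  case (single i c)
  show ?case
  proof (induction y rule: pm_induct)
    case (single j d)
    show ?case
    proof (induction x' rule: pm_induct)
      case (single i' c')
      show ?case
        by (induction y' rule: pm_induct)
          (simp_all add: tensor_single mult_single tensor_add_right distrib_left distrib_right mult_ac)
    qed (simp add: tensor_add_left distrib_left)
  qed (simp add: tensor_add_right distrib_right)
qed (simp add: tensor_add_left distrib_right)


section \<open>Graded bialgebras\<close>

locale bialgebra =
  fixes mul :: "('b \<Rightarrow>\<^sub>0 'k::field) \<Rightarrow> ('b \<Rightarrow>\<^sub>0 'k) \<Rightarrow> ('b \<Rightarrow>\<^sub>0 'k)"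
    and one :: "'b \<Rightarrow>\<^sub>0 'k"
    and coprod :: "('b \<Rightarrow>\<^sub>0 'k) \<Rightarrow> ('b \<times> 'b \<Rightarrow>\<^sub>0 'k)"
    and counit :: "('b \<Rightarrow>\<^sub>0 'k) \<Rightarrow> 'k"
  assumes mul_bilinear: "bilinear_pm mul"
    and mul_assoc: "mul (mul x y) z = mul x (mul y z)"
    and mul_one_left: "mul one x = x"
    and mul_one_right: "mul x one = x"
    and coprod_linear: "Vector_Spaces.linear pm_scale pm_scale coprod"
    and counit_linear: "Vector_Spaces.linear pm_scale (*) counit"
    and coassoc:
      "tensor_assoc (tensor_map coprod id (coprod x)) = tensor_map id coprod (coprod x)"
    and counit_left: "tensor_lift (\<lambda>y z. pm_scale (counit y) z) (coprod x) = x"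
    and counit_right: "tensor_lift (\<lambda>y z. pm_scale (counit z) y) (coprod x) = x"
    and coprod_mul: "coprod (mul x y) = tensor_mul mul (coprod x) (coprod y)"
    and coprod_one: "coprod one = tensor one one"
    and counit_mul: "counit (mul x y) = counit x * counit y"
    and counit_one: "counit one = 1"

locale graded_bialgebra = bialgebra mul one coprod counit
  for mul :: "('b \<Rightarrow>\<^sub>0 'k::field) \<Rightarrow> ('b \<Rightarrow>\<^sub>0 'k) \<Rightarrow> ('b \<Rightarrow>\<^sub>0 'k)"
    and one :: "'b \<Rightarrow>\<^sub>0 'k"
    and coprod :: "('b \<Rightarrow>\<^sub>0 'k) \<Rightarrow> ('b \<times> 'b \<Rightarrow>\<^sub>0 'k)"
    and counit :: "('b \<Rightarrow>\<^sub>0 'k) \<Rightarrow> 'k" +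
  fixes homog :: "nat \<Rightarrow> ('b \<Rightarrow>\<^sub>0 'k) set"
  assumes homog_subspace: "module.subspace pm_scale (homog n)"
    and direct_sum: "\<exists>!f. (\<forall>n. f n \<in> homog n) \<and> finite {n. f n \<noteq> 0} \<and> x = (\<Sum>n | f n \<noteq> 0. f n)"
    and one_homog: "one \<in> homog 0"
    and mul_homog: "x \<in> homog m \<Longrightarrow> y \<in> homog n \<Longrightarrow> mul x y \<in> homog (m + n)"
    and coprod_homog: "x \<in> homog n \<Longrightarrow>
      coprod x \<in> module.span pm_scale {tensor y z | y z. \<exists>p q. p + q = n \<and> y \<in> homog p \<and> z \<in> homog q}"
    and counit_homog: "x \<in> homog n \<Longrightarrow> n \<noteq> 0 \<Longrightarrow> counit x = 0"


section \<open>Rooted trees and admissible cuts\<close>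

definition roots :: "'a pair_pre_digraph \<Rightarrow> 'a set" where
  "roots G = {v \<in> pverts G. in_degree G v = 0}"

definition leaves :: "'a pair_pre_digraph \<Rightarrow> 'a set" where
  "leaves G = {v \<in> pverts G. out_degree G v = 0}"

text \<open>
  The underlying undirected graph is connected and has no cycle, that is, no loop or double edge
  (second condition) and no cycle of length at least \<open>3\<close>. The length bound is needed because going
  back and forth along an edge counts as a \<^const>\<open>pre_digraph.cycle\<close> of \<^term>\<open>mk_symmetric G\<close>.
\<close>

definition simply_connected :: "'a pair_pre_digraph \<Rightarrow> bool" where
  "simply_connected G \<longleftrightarrow> connected G \<and>
     (\<forall>u v. (u, v) \<in> parcs G \<longrightarrow> (v, u) \<notin> parcs G) \<and>
     \<not> (\<exists>p. pre_digraph.cycle (mk_symmetric G) p \<and> length p \<ge> 3)"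

definition rooted_tree :: "'a pair_pre_digraph \<Rightarrow> bool" where
  "rooted_tree G \<longleftrightarrow> pair_fin_digraph G \<and> simply_connected G \<and>
     (\<exists>r\<in>pverts G. in_degree G r = 0 \<and> (\<forall>v\<in>pverts G - {r}. in_degree G v = 1))"

definition pair_induce :: "'a pair_pre_digraph \<Rightarrow> 'a set \<Rightarrow> 'a pair_pre_digraph" where
  "pair_induce G S = \<lparr> pverts = S, parcs = {e \<in> parcs G. fst e \<in> S \<and> snd e \<in> S} \<rparr>"

definition pair_Union :: "'a pair_pre_digraph set \<Rightarrow> 'a pair_pre_digraph" where
  "pair_Union \<G> = \<lparr> pverts = (\<Union>G\<in>\<G>. pverts G), parcs = (\<Union>G\<in>\<G>. parcs G) \<rparr>"

definition components :: "'a pair_pre_digraph \<Rightarrow> 'a pair_pre_digraph set" where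
  "components G = pair_induce G ` pre_digraph.sccs_verts (mk_symmetric G)"

datatype 'a tree_cut = Edges "('a \<times> 'a) set" | Total

definition Adm_tree :: "'a pair_pre_digraph \<Rightarrow> 'a tree_cut set" where
  "Adm_tree t = insert Total {Edges c | c. c \<subseteq> parcs t \<and>
     (\<forall>r\<in>roots t. \<forall>l\<in>leaves t. \<forall>p. pre_digraph.apath t r p l \<longrightarrow> card (set p \<inter> c) \<le> 1)}"

fun verts_above :: "'a pair_pre_digraph \<Rightarrow> 'a tree_cut \<Rightarrow> 'a set" where
  "verts_above t (Edges c) = {v. \<exists>(x, y)\<in>c. reachable t y v}"
| "verts_above t Total = pverts t"

definition tree_pruning :: "'a pair_pre_digraph \<Rightarrow> 'a tree_cut \<Rightarrow> 'a pair_pre_digraph" where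
  "tree_pruning t c = pair_induce t (verts_above t c)"

definition tree_trunk :: "'a pair_pre_digraph \<Rightarrow> 'a tree_cut \<Rightarrow> 'a pair_pre_digraph" where
  "tree_trunk t c = pair_induce t (pverts t - verts_above t c)"

text \<open>A cut of a forest assigns to each component a cut of that component.\<close>

type_synonym 'a forest_cut = "'a pair_pre_digraph \<Rightarrow> 'a tree_cut"

definition Adm :: "'a pair_pre_digraph \<Rightarrow> 'a forest_cut set" where
  "Adm s = (\<Pi>\<^sub>E T\<in>components s. Adm_tree T)"

lemma finite_Adm:
  assumes "finite (pverts s)" "finite (parcs s)"
  shows "finite (Adm s)"
proof -
  have "pre_digraph.sccs_verts (mk_symmetric s) \<subseteq> Pow (pverts s)"
    by (auto simp: pre_digraph.sccs_verts_def reachable_def mk_symmetric_def dest!: bspec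
        dest: in_rtrancl_on_in_F)
  then have "finite (components s)"
    using assms(1) by (auto simp: components_def intro: finite_subset)
  moreover have "finite (Adm_tree T)" if "T \<in> components s" for T
  proof -
    from that have "parcs T \<subseteq> parcs s"
      by (auto simp: components_def pair_induce_def)
    then have "Adm_tree T \<subseteq> insert Total (Edges ` Pow (parcs s))"
      by (auto simp: Adm_tree_def)
    then show ?thesis using assms(2) by (auto intro: finite_subset)
  qed
  ultimately show ?thesis
    unfolding Adm_def by (intro finite_PiE)
qed

definition pruning :: "'a pair_pre_digraph \<Rightarrow> 'a forest_cut \<Rightarrow> 'a pair_pre_digraph" where
  "pruning s c = pair_Union ((\<lambda>T. tree_pruning T (c T)) ` components s)"

definition trunk :: "'a pair_pre_digraph \<Rightarrow> 'a forest_cut \<Rightarrow> 'a pair_pre_digraph" where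
  "trunk s c = pair_Union ((\<lambda>T. tree_trunk T (c T)) ` components s)"

text \<open>For a cut \<open>c\<close> of a pruning \<open>s\<close> of \<open>t\<close>, the trunk \<open>R\<^sup>c(t)\<close> of the whole tree.\<close>

definition ambient_trunk ::
  "'a pair_pre_digraph \<Rightarrow> 'a pair_pre_digraph \<Rightarrow> 'a forest_cut \<Rightarrow> 'a pair_pre_digraph" where
  "ambient_trunk t s c = pair_induce t (pverts t - pverts (pruning s c))"


section \<open>Couples up to isomorphism\<close>

definition is_couple :: "'a pair_pre_digraph \<times> 'a pair_pre_digraph \<Rightarrow> bool" where
  "is_couple = (\<lambda>(t, s). rooted_tree t \<and> (\<exists>c\<in>Adm_tree t. s = tree_pruning t c))"

definition couple_iso ::
  "'a pair_pre_digraph \<times> 'a pair_pre_digraph \<Rightarrow> 'a pair_pre_digraph \<times> 'a pair_pre_digraph \<Rightarrow> bool" where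
  "couple_iso = (\<lambda>(t, s) (t', s'). is_couple (t, s) \<and> is_couple (t', s') \<and>
     (\<exists>h. pre_digraph.digraph_isomorphism t h \<and>
        with_proj t' = app_iso h t \<and> with_proj s' = app_iso h s))"

lemma is_couple_subset:
  assumes "is_couple (t, s)"
  shows "pverts s \<subseteq> pverts t" "parcs s \<subseteq> parcs t" "parcs t \<subseteq> pverts t \<times> pverts t"
proof -
  from assms obtain c where t: "rooted_tree t" and s: "s = tree_pruning t c"
    by (auto simp: is_couple_def)
  from t interpret pair_fin_digraph t by (simp add: rooted_tree_def)
  show "parcs t \<subseteq> pverts t \<times> pverts t"
    using arc_fst_in_verts arc_snd_in_verts by fastforce
  have "verts_above t c \<subseteq> pverts t"
    by (cases c) (auto simp: reachable_def dest: in_rtrancl_on_in_F)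
  then show "pverts s \<subseteq> pverts t" "parcs s \<subseteq> parcs t"
    by (auto simp: s tree_pruning_def pair_induce_def)
qed

lemma couple_iso_iff:
  "couple_iso (t, s) (t', s') \<longleftrightarrow> is_couple (t, s) \<and> is_couple (t', s') \<and>
     (\<exists>f. inj_on f (pverts t) \<and>
        pverts t' = f ` pverts t \<and> parcs t' = map_prod f f ` parcs t \<and>
        pverts s' = f ` pverts s \<and> parcs s' = map_prod f f ` parcs s)"
  (is "?L \<longleftrightarrow> ?R")
proof
  assume L: ?L
  then obtain h where c: "is_couple (t, s)" "is_couple (t', s')"
    and h: "pre_digraph.digraph_isomorphism t h"
    and t': "with_proj t' = app_iso h t" and s': "with_proj s' = app_iso h s"
    by (auto simp: couple_iso_def)
  let ?f = "iso_verts h"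
  have th: "iso_tail h = fst" "iso_head h = snd"
    using arg_cong[OF t', of tail] arg_cong[OF t', of head] by auto
  have arc: "iso_arcs h a = map_prod ?f ?f a" if "a \<in> parcs t" for a
    using h that by (auto simp: pre_digraph.digraph_isomorphism_def th prod_eq_iff)
  have "inj_on ?f (pverts t)"
    using h by (simp add: pre_digraph.digraph_isomorphism_def)
  moreover have "pverts t' = ?f ` pverts t" "pverts s' = ?f ` pverts s"
    using arg_cong[OF t', of verts] arg_cong[OF s', of verts] by auto
  moreover have "iso_arcs h ` A = map_prod ?f ?f ` A" if "A \<subseteq> parcs t" for A
    using that arc by (intro image_cong) auto
  then have "parcs t' = map_prod ?f ?f ` parcs t" "parcs s' = map_prod ?f ?f ` parcs s"
    using arg_cong[OF t', of arcs] arg_cong[OF s', of arcs] is_couple_subset(2)[OF c(1)] by simp_all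
  ultimately show ?R using c by (intro conjI exI[of _ ?f])
next
  assume R: ?R
  then obtain f where c: "is_couple (t, s)" "is_couple (t', s')" and f: "inj_on f (pverts t)"
    and eqs: "pverts t' = f ` pverts t" "parcs t' = map_prod f f ` parcs t"
      "pverts s' = f ` pverts s" "parcs s' = map_prod f f ` parcs s"
    by metis
  define h where
    "h = \<lparr> iso_verts = f, iso_arcs = map_prod f f, iso_head = snd, iso_tail = fst \<rparr>"
  from c(1) interpret pair_fin_digraph t by (simp add: is_couple_def rooted_tree_def)
  have "inj_on (map_prod f f) (parcs t)"
    using map_prod_inj_on[OF f f] is_couple_subset(3)[OF c(1)] by (rule inj_on_subset)
  then have "pre_digraph.digraph_isomorphism t h"
    using f wf_digraph by (auto simp: pre_digraph.digraph_isomorphism_def h_def)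
  moreover have "with_proj t' = app_iso h t" "with_proj s' = app_iso h s"
    using eqs by (simp_all add: with_proj_def app_iso_def h_def)
  ultimately show ?L using c by (auto simp: couple_iso_def)
qed

lemma couple_iso_refl: "is_couple x \<Longrightarrow> couple_iso x x"
  by (cases x) (auto simp: couple_iso_iff prod.map_id0 intro!: exI[of _ id])

lemma couple_iso_sym:
  assumes "couple_iso x y"
  shows "couple_iso y x"
proof -
  obtain t s t' s' where x [simp]: "x = (t, s)" and y [simp]: "y = (t', s')" by (cases x, cases y)
  from assms obtain f where c: "is_couple (t, s)" "is_couple (t', s')" and f: "inj_on f (pverts t)"
    and eqs: "pverts t' = f ` pverts t" "parcs t' = map_prod f f ` parcs t"
      "pverts s' = f ` pverts s" "parcs s' = map_prod f f ` parcs s"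
    by (auto simp: couple_iso_iff)
  let ?g = "the_inv_into (pverts t) f"
  note sub = is_couple_subset[OF c(1)]
  have g: "?g (f v) = v" if "v \<in> pverts t" for v
    using f that by (rule the_inv_into_f_f)
  have "inj_on ?g (pverts t')"
    unfolding eqs by (rule inj_on_the_inv_into[OF f])
  moreover have "?g ` f ` A = A" if "A \<subseteq> pverts t" for A
  proof -
    have "?g ` f ` A = (\<lambda>v. ?g (f v)) ` A" by (rule image_image)
    also have "\<dots> = (\<lambda>v. v) ` A" using that g by (intro image_cong) auto
    finally show ?thesis by simp
  qed
  moreover have "map_prod ?g ?g ` map_prod f f ` A = A" if "A \<subseteq> parcs t" for A
  proof -
    have "map_prod ?g ?g (map_prod f f a) = a" if "a \<in> A" for a
      using that \<open>A \<subseteq> parcs t\<close> sub(3) g by (cases a) auto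
    then have "(\<lambda>a. map_prod ?g ?g (map_prod f f a)) ` A = (\<lambda>a. a) ` A" by (intro image_cong) auto
    then show ?thesis by (simp add: image_image)
  qed
  ultimately show ?thesis
    unfolding couple_iso_iff x y
    using c sub by (intro conjI exI[of _ ?g]) (simp_all add: eqs)
qed

lemma couple_iso_trans:
  assumes "couple_iso x y" "couple_iso y z"
  shows "couple_iso x z"
proof -
  obtain t s t' s' t'' s'' where x [simp]: "x = (t, s)" and y [simp]: "y = (t', s')" and z [simp]: "z = (t'', s'')"
    by (cases x, cases y, cases z)
  from assms(1) obtain f where f: "is_couple (t, s)" "inj_on f (pverts t)"
      "pverts t' = f ` pverts t" "parcs t' = map_prod f f ` parcs t"
      "pverts s' = f ` pverts s" "parcs s' = map_prod f f ` parcs s"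
    by (auto simp: couple_iso_iff)
  from assms(2) obtain g where g: "is_couple (t'', s'')" "inj_on g (pverts t')"
      "pverts t'' = g ` pverts t'" "parcs t'' = map_prod g g ` parcs t'"
      "pverts s'' = g ` pverts s'" "parcs s'' = map_prod g g ` parcs s'"
    by (auto simp: couple_iso_iff)
  have "inj_on (g \<circ> f) (pverts t)"
    using f g by (auto intro: comp_inj_on)
  moreover have "map_prod (g \<circ> f) (g \<circ> f) = map_prod g g \<circ> map_prod f f"
    by (auto simp: fun_eq_iff)
  ultimately show ?thesis
    unfolding couple_iso_iff x z
    using f g by (intro conjI exI[of _ "g \<circ> f"]) (simp_all add: image_comp)
qed

text \<open>Every finite graph is isomorphic to one with vertices in \<^typ>\<open>nat\<close>.\<close>

quotient_type couple = "nat pair_pre_digraph \<times> nat pair_pre_digraph" / partial: couple_iso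
proof (rule part_equivpI)
  let ?t = "\<lparr> pverts = {0}, parcs = {} \<rparr> :: nat pair_pre_digraph"
  have "rooted_tree ?t"
    unfolding rooted_tree_def
  proof (intro conjI)
    show "pair_fin_digraph ?t"
      by unfold_locales auto
    have "arcs (mk_symmetric ?t) = {}"
      by (simp add: mk_symmetric_def)
    then have "\<not> pre_digraph.cycle (mk_symmetric ?t) p" for p
      by (auto simp: pre_digraph.cycle_def pre_digraph.awalk_def)
    moreover have "connected ?t"
      by (auto simp: connected_def strongly_connected_def mk_symmetric_def reachable_def)
    ultimately show "simply_connected ?t"
      by (simp add: simply_connected_def)
    show "\<exists>r\<in>pverts ?t. in_degree ?t r = 0 \<and> (\<forall>v\<in>pverts ?t - {r}. in_degree ?t v = 1)"
      by (auto simp: in_degree_def in_arcs_def)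
  qed
  then have "is_couple (?t, tree_pruning ?t Total)"
    by (auto simp: is_couple_def Adm_tree_def)
  then show "\<exists>x :: nat pair_pre_digraph \<times> nat pair_pre_digraph. couple_iso x x"
    by (blast intro: couple_iso_refl)
qed (auto intro!: sympI transpI intro: couple_iso_sym couple_iso_trans)

text \<open>
  \<open>D = S(V)\<close> is the polynomial algebra on the isomorphism classes of couples: a basis is given by the
  monomials, that is, finite multisets of couples, and the product is the convolution product
  \<^term>\<open>(*)\<close> of \<^typ>\<open>couple multiset \<Rightarrow>\<^sub>0 'k\<close>. A monomial stands for the forest couple
  whose components are its factors. By \<open>tensor_mult\<close>, the product \<^term>\<open>(*)\<close> on
  \<^typ>\<open>couple multiset \<times> couple multiset \<Rightarrow>\<^sub>0 'k\<close> is that of the algebra \<open>D \<otimes> D\<close>.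
\<close>

type_synonym 'k doubled = "couple multiset \<Rightarrow>\<^sub>0 'k"
type_synonym 'k doubled2 = "couple multiset \<times> couple multiset \<Rightarrow>\<^sub>0 'k"

text \<open>The empty couple is identified with the unit.\<close>

definition couple_elem :: "nat pair_pre_digraph \<Rightarrow> nat pair_pre_digraph \<Rightarrow> 'k::field doubled" where
  "couple_elem t s = (if pverts t = {} then 1 else Poly_Mapping.single {#abs_couple (t, s)#} 1)"

definition forest_counit :: "'a pair_pre_digraph \<Rightarrow> 'k::field" where
  "forest_counit s = (if pverts s = {} then 1 else 0)"

definition couple_coprod :: "nat pair_pre_digraph \<Rightarrow> nat pair_pre_digraph \<Rightarrow> 'k::field doubled2" where
  "couple_coprod t s = (\<Sum>c\<in>Adm s.
     tensor (couple_elem t (pruning s c)) (couple_elem (ambient_trunk t s c) (trunk s c)))"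

text \<open>
  The degree, coproduct and counit of an isomorphism class are those of its representative
  \<^const>\<open>rep_couple\<close>; they do not depend on the representative.
\<close>

definition couple_degree :: "couple \<Rightarrow> nat" where
  "couple_degree x = card (pverts (snd (rep_couple x)))"

definition doubled_coprod :: "'k::field doubled \<Rightarrow> 'k doubled2" where
  "doubled_coprod = lin_ext pm_scale
     (\<lambda>M. \<Prod>x\<in>#M. couple_coprod (fst (rep_couple x)) (snd (rep_couple x)))"

definition doubled_counit :: "'k::field doubled \<Rightarrow> 'k" where
  "doubled_counit = lin_ext (*) (\<lambda>M. \<Prod>x\<in>#M. forest_counit (snd (rep_couple x)))"

definition doubled_homog :: "nat \<Rightarrow> 'k::field doubled set" where
  "doubled_homog n =
     {x. \<forall>M\<in>Poly_Mapping.keys x. (\<Sum>y\<in>#M. couple_degree y) = n}"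

end

theory Submission
  imports Defs
begin

text \<open>
  Nothing in the coproduct depends on the edges that a cut removes, only on the vertices above it.
  Call a set of vertices of a graph an \<^emph>\<open>upper set\<close> if it contains the head of every arc whose tail it
  contains. In a rooted tree the set of vertices above an admissible cut is an upper set, and a cut is
  recovered from it: the total cut gives the set of all vertices, and any other cut consists of the
  arcs entering the set from outside (\<open>bij_betw_verts_above\<close>). In a rooted forest an upper set is a
  choice of one upper set in each component, so \<open>Adm s\<close> is in bijection with the upper sets of \<open>s\<close>
  (\<open>bij_betw_pruning\<close>). Write \<open>t[U]\<close> for the graph induced by \<open>t\<close> on \<open>U\<close>. A couple is a pair
  \<open>(t, t[U])\<close> with \<open>U\<close> an upper set of the rooted tree \<open>t\<close>, and if \<open>V\<close> is the set of vertices of \<open>t\<close>,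
  the coproduct reads
    \<open>\<Delta>(t, t[U]) = (\<Sum>W. (t, t[W]) \<otimes> (t[V - W], t[U - W]))\<close>,
  the sum being over the upper sets \<open>W \<subseteq> U\<close> of \<open>t\<close> (\<open>couple_coprod_upper_sets\<close>). The right-hand
  factors are couples again, because removing a proper upper set from a rooted tree leaves a rooted
  tree (\<open>rooted_tree_trunk\<close>); for \<open>W = V\<close> the right-hand factor is the unit.

  In this form coassociativity is a reindexing. One side is a sum over chains \<open>X \<subseteq> W \<subseteq> U\<close> of upper
  sets of \<open>t\<close>, the other over an upper set \<open>X\<close> of \<open>t\<close> and an upper set \<open>Y\<close> of \<open>t[V - X]\<close> inside \<open>U - X\<close>;
  the two are matched by \<open>W = X \<union> Y\<close> (\<open>doubled_coassoc\<close>). In the counit laws only \<open>W = {}\<close>,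
  respectively \<open>W = U\<close>, survives (\<open>doubled_counit_laws\<close>). Homogeneity is \<open>|W| + |U - W| = |U|\<close>. All maps
  involved are algebra homomorphisms, and these are determined by their values on single couples
  (\<open>algebra_hom_eq\<close>), so it is enough to check the laws there.

  An isomorphism of couples carries upper sets to upper sets, which makes the formula independent of
  the representatives by which the coproduct of an isomorphism class is defined (\<open>couple_coprod_iso\<close>).
\<close>

section \<open>Upper sets of a graph\<close>

definition upper_sets :: "'a pair_pre_digraph \<Rightarrow> 'a set set" where
  "upper_sets G = {U. U \<subseteq> pverts G \<and> (\<forall>(x, y)\<in>parcs G. x \<in> U \<longrightarrow> y \<in> U)}"

lemma upper_setsD:
  assumes "U \<in> upper_sets G"
  shows "U \<subseteq> pverts G" "(x, y) \<in> parcs G \<Longrightarrow> x \<in> U \<Longrightarrow> y \<in> U"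
  using assms by (auto simp: upper_sets_def)

lemma upper_sets_rtrancl:
  assumes "U \<in> upper_sets G" "(x, y) \<in> (parcs G)\<^sup>*" "x \<in> U"
  shows "y \<in> U"
  using assms(2,3) by (induction rule: rtrancl_induct) (auto dest: upper_setsD(2)[OF assms(1)])

lemma empty_upper_set [simp]: "{} \<in> upper_sets G"
  by (auto simp: upper_sets_def)

lemma pair_induce_simps [simp]:
  "pverts (pair_induce G S) = S"
  "parcs (pair_induce G S) = {e \<in> parcs G. fst e \<in> S \<and> snd e \<in> S}"
  by (simp_all add: pair_induce_def)

lemma pair_induce_pair_induce [simp]:
  "B \<subseteq> A \<Longrightarrow> pair_induce (pair_induce G A) B = pair_induce G B"
  by (auto simp: pair_induce_def)

lemma upper_sets_pair_induce:
  assumes "U \<in> upper_sets G"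
  shows "upper_sets (pair_induce G U) = {W \<in> upper_sets G. W \<subseteq> U}"
  using upper_setsD[OF assms] by (fastforce simp: upper_sets_def)

text \<open>
  The upper sets of a trunk correspond to the upper sets of the whole graph that contain the removed
  part. This is what turns iterated cuts into chains of upper sets.
\<close>

lemma upper_sets_trunk:
  assumes "W \<in> upper_sets G" and wf: "\<And>x y. (x, y) \<in> parcs G \<Longrightarrow> y \<in> pverts G"
  shows "upper_sets (pair_induce G (pverts G - W)) =
    {Y. Y \<subseteq> pverts G - W \<and> W \<union> Y \<in> upper_sets G}"
proof (intro set_eqI iffI)
  fix Y assume Y: "Y \<in> upper_sets (pair_induce G (pverts G - W))"
  have sub: "Y \<subseteq> pverts G - W"
    using upper_setsD(1)[OF Y] by simp
  moreover have "y \<in> W \<union> Y" if "(x, y) \<in> parcs G" "x \<in> Y" for x y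
    using upper_setsD(2)[OF Y, of x y] that sub wf[OF that(1)] by auto
  ultimately show "Y \<in> {Y. Y \<subseteq> pverts G - W \<and> W \<union> Y \<in> upper_sets G}"
    using upper_setsD[OF assms(1)] unfolding upper_sets_def by blast
next
  fix Y assume "Y \<in> {Y. Y \<subseteq> pverts G - W \<and> W \<union> Y \<in> upper_sets G}"
  then show "Y \<in> upper_sets (pair_induce G (pverts G - W))"
    unfolding upper_sets_def by auto
qed

section \<open>Admissible cuts of a rooted tree\<close>

text \<open>
  The last arc of a path from \<open>r\<close> to \<open>v\<close> can only come from the parent of \<open>v\<close>.
\<close>

lemma parent_reachable:
  assumes "single_valued (E\<inverse>)" "\<And>x. (x, r) \<notin> E"
    and "(r, v) \<in> E\<^sup>*" "(u, v) \<in> E"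
  shows "(r, u) \<in> E\<^sup>*"
  using assms(3)
proof (cases rule: rtranclE)
  case base
  then show ?thesis using assms(2,4) by simp
next
  case (step y)
  then show ?thesis using single_valuedD[OF assms(1), of v u y] assms(4) by simp
qed

text \<open>
  The set of descendants of a parentless vertex is closed under passing to children trivially and
  under passing to parents by uniqueness of parents, so it is a whole connected component.
\<close>

lemma reachable_of_sym_reachable:
  assumes "single_valued (E\<inverse>)" "\<And>x. (x, r) \<notin> E"
    and "(r, v) \<in> (E \<union> E\<inverse>)\<^sup>*"
  shows "(r, v) \<in> E\<^sup>*"
  using assms(3)
proof (induction rule: rtrancl_induct)
  case (step y z)
  then show ?case
    using parent_reachable[OF assms(1,2) step.IH] by (auto intro: rtrancl_into_rtrancl)
qed simp

text \<open>
  A cycle through a child of \<open>y\<close> must pass through \<open>y\<close>, its only parent. Cycles can thus be moved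
  towards the root, which has no incoming arc.
\<close>

lemma acyclic_of_root:
  assumes "single_valued (E\<inverse>)" "\<And>x. (x, r) \<notin> E"
    and "\<And>x y. (x, y) \<in> E \<Longrightarrow> (r, y) \<in> E\<^sup>*"
  shows "acyclic E"
proof -
  have "(v, v) \<notin> E\<^sup>+" if "(r, v) \<in> E\<^sup>*" for v
    using that
  proof (induction rule: rtrancl_induct)
    case base
    then show ?case using assms(2) by (auto dest: tranclD2)
  next
    case (step y z)
    show ?case
    proof
      assume "(z, z) \<in> E\<^sup>+"
      then obtain w where w: "(z, w) \<in> E\<^sup>*" "(w, z) \<in> E" by (auto dest: tranclD2)
      then have "w = y" using single_valuedD[OF assms(1), of z w y] step by simp
      then have "(y, y) \<in> E\<^sup>+" using w step by (auto intro: rtrancl_into_trancl2)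
      then show False using step by simp
    qed
  qed
  moreover have "(r, v) \<in> E\<^sup>*" if "(v, v) \<in> E\<^sup>+" for v
    using that assms(3) by (auto dest: tranclD2)
  ultimately show ?thesis by (auto simp: acyclic_def)
qed

text \<open>
  Trunks, prunings and components are induced subgraphs. The following properties pass to induced
  subgraphs, whereas connectedness does not.
\<close>

locale rooted_forest = pair_fin_digraph G for G :: "'a pair_pre_digraph" +
  assumes parent_unique: "(x, v) \<in> parcs G \<Longrightarrow> (y, v) \<in> parcs G \<Longrightarrow> x = y"
    and acyclic: "acyclic (parcs G)"
begin

lemma reachable_iff: "u \<in> pverts G \<Longrightarrow> reachable (with_proj G) u v \<longleftrightarrow> (u, v) \<in> (parcs G)\<^sup>*"
  using reachable_conv' by simp

lemma single_valued_converse: "single_valued ((parcs G)\<inverse>)"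
  using parent_unique by (auto intro: single_valuedI)

lemma no_return: "(u, v) \<in> (parcs G)\<^sup>* \<Longrightarrow> (v, u) \<notin> parcs G"
  using acyclic by (auto simp: acyclic_def intro: rtrancl_into_trancl1)

text \<open>
  The admissibility condition speaks of paths with distinct vertices. In an acyclic graph every
  walk is one, so walks may be concatenated freely.
\<close>

lemma walk_is_path:
  assumes "awalk u p v"
  shows "apath u p v"
proof (rule ccontr)
  assume "\<not> apath u p v"
  then have "\<not> distinct (pawalk_verts u p)"
    using assms by (simp add: apath_def)
  then obtain r w where "awalk w r w" "r \<noteq> []"
    using awalk_not_distinct_decomp[OF assms] by auto
  then have "(w, w) \<in> (parcs G)\<^sup>+" using reachable1_awalk by auto
  then show False using acyclic by (auto simp: acyclic_def)
qed

text \<open>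
  Admissibility only constrains paths that end in a leaf; every walk can be prolonged to one of these.
\<close>

lemma reaches_leaf:
  assumes "y \<in> pverts G"
  shows "\<exists>l\<in>leaves G. (y, l) \<in> (parcs G)\<^sup>*"
proof -
  have "wf ((parcs G)\<inverse>)"
    using pair_finite_arcs acyclic by (rule finite_acyclic_wf_converse)
  then obtain l where l: "(y, l) \<in> (parcs G)\<^sup>*" "\<And>w. (l, w) \<in> parcs G \<Longrightarrow> (y, w) \<notin> (parcs G)\<^sup>*"
    by (rule wfE_min[of _ y "{v. (y, v) \<in> (parcs G)\<^sup>*}"]) auto
  then have "out_arcs (with_proj G) l = {}"
    by (auto simp: out_arcs_def intro: rtrancl_into_rtrancl)
  moreover have "l \<in> pverts G" using assms l(1) reachable_iff reachable_in_verts by blast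
  ultimately show ?thesis using l(1) by (auto simp: leaves_def out_degree_def)
qed

lemma exists_root:
  assumes "C \<noteq> {}" "C \<subseteq> pverts G" "\<And>x y. (x, y) \<in> parcs G \<Longrightarrow> y \<in> C \<Longrightarrow> x \<in> C"
  shows "\<exists>r\<in>C. \<forall>x. (x, r) \<notin> parcs G"
proof -
  have "wf (parcs G)"
    using pair_finite_arcs acyclic by (rule finite_acyclic_wf)
  then obtain r where "r \<in> C" "\<And>x. (x, r) \<in> parcs G \<Longrightarrow> x \<notin> C"
    using assms(1) by (metis ex_in_conv wfE_min)
  then show ?thesis using assms(3) by blast
qed

lemma rooted_forest_pair_induce:
  assumes "S \<subseteq> pverts G"
  shows "rooted_forest (pair_induce G S)"
proof unfold_locales
  show "finite (pverts (pair_induce G S))"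
    using assms pair_finite_verts by (auto intro: finite_subset)
  show "acyclic (parcs (pair_induce G S))"
    by (rule acyclic_subset[OF acyclic]) auto
qed (use pair_finite_arcs parent_unique in auto)

lemma verts_above_Edges:
  assumes "c \<subseteq> parcs G"
  shows "verts_above G (Edges c) = {v. \<exists>x y. (x, y) \<in> c \<and> (y, v) \<in> (parcs G)\<^sup>*}"
proof -
  have "reachable (with_proj G) y v \<longleftrightarrow> (y, v) \<in> (parcs G)\<^sup>*" if "(x, y) \<in> c" for x y v
    using that assms by (intro reachable_iff in_arcsD2) auto
  then have "(\<exists>x y. (x, y) \<in> c \<and> reachable (with_proj G) y v) \<longleftrightarrow>
      (\<exists>x y. (x, y) \<in> c \<and> (y, v) \<in> (parcs G)\<^sup>*)" for v
    by blast
  then show ?thesis by (simp add: split_beta Bex_def)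
qed

lemma verts_above_upper_set:
  assumes "k \<in> Adm_tree G"
  shows "verts_above G k \<in> upper_sets G"
proof (cases k)
  case (Edges c)
  then have c: "c \<subseteq> parcs G" using assms by (auto simp: Adm_tree_def)
  have "v \<in> pverts G" if "(x, y) \<in> c" "(y, v) \<in> (parcs G)\<^sup>*" for x y v
    using that(2) c that(1) by (induction rule: rtrancl_induct) (auto dest: in_arcsD2)
  then show ?thesis
    unfolding Edges verts_above_Edges[OF c]
    by (auto simp: upper_sets_def intro: rtrancl_into_rtrancl)
qed (auto simp: upper_sets_def dest: in_arcsD2)

definition boundary :: "'a set \<Rightarrow> ('a \<times> 'a) set" where
  "boundary U = {(x, y) \<in> parcs G. x \<notin> U \<and> y \<in> U}"

text \<open>
  A walk that has entered an upper set never leaves it, hence crosses the boundary at most once.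
\<close>

lemma card_walk_boundary:
  assumes "U \<in> upper_sets G" "set p \<subseteq> parcs G" "pcas u p v"
  shows "card (set p \<inter> boundary U) \<le> 1" "u \<in> U \<Longrightarrow> set p \<inter> boundary U = {}"
  using assms(2,3)
proof (induction p arbitrary: u)
  case (Cons e p)
  { case 1
    show ?case
    proof (cases "e \<in> boundary U")
      case True
      then have "set p \<inter> boundary U = {}"
        using 1 Cons(2)[of "snd e"] by (auto simp: boundary_def)
      then show ?thesis using True by simp
    next
      case False
      then show ?thesis using 1 Cons(1)[of "snd e"] by simp
    qed }
  { case 2
    then have "snd e \<in> U" using upper_setsD(2)[OF assms(1), of u "snd e"] by (cases e) auto
    then show ?case using 2 Cons(2)[of "snd e"] by (auto simp: boundary_def) }
qed auto

lemma boundary_admissible: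
  assumes "U \<in> upper_sets G"
  shows "Edges (boundary U) \<in> Adm_tree G"
  using card_walk_boundary(1)[OF assms]
  by (auto simp: Adm_tree_def apath_def awalk_def boundary_def)

end

locale rooted_arborescence = rooted_forest G for G :: "'a pair_pre_digraph" +
  fixes r
  assumes root: "r \<in> pverts G" "(x, r) \<notin> parcs G"
    and root_reaches: "v \<in> pverts G \<Longrightarrow> (r, v) \<in> (parcs G)\<^sup>*"
begin

lemma root_in_upper_set: "U \<in> upper_sets G \<Longrightarrow> r \<in> U \<Longrightarrow> U = pverts G"
  using upper_sets_rtrancl[of U G r] root_reaches upper_setsD(1)[of U G] by auto

lemma verts_above_boundary:
  assumes "U \<in> upper_sets G" "r \<notin> U"
  shows "verts_above G (Edges (boundary U)) = U"
proof -
  have b: "boundary U \<subseteq> parcs G" by (auto simp: boundary_def)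
  have "\<exists>x y. (x, y) \<in> boundary U \<and> (y, v) \<in> (parcs G)\<^sup>*" if "(r, v) \<in> (parcs G)\<^sup>*" "v \<in> U" for v
    using that
  proof (induction rule: rtrancl_induct)
    case base
    then show ?case using assms by simp
  next
    case (step y z)
    show ?case
    proof (cases "y \<in> U")
      case True
      then show ?thesis using step by (auto intro: rtrancl_into_rtrancl)
    next
      case False
      then show ?thesis using step by (auto simp: boundary_def)
    qed
  qed
  moreover have "v \<in> U" if "(x, y) \<in> boundary U" "(y, v) \<in> (parcs G)\<^sup>*" for x y v
    using upper_sets_rtrancl[OF assms(1) that(2)] that(1) by (auto simp: boundary_def)
  ultimately show ?thesis
    unfolding verts_above_Edges[OF b] using root_reaches upper_setsD(1)[OF assms(1)] by blast
qed

lemma root_not_above: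
  assumes "c \<subseteq> parcs G"
  shows "r \<notin> verts_above G (Edges c)"
proof
  assume "r \<in> verts_above G (Edges c)"
  then obtain x y where xy: "(x, y) \<in> c" "(y, r) \<in> (parcs G)\<^sup>*"
    unfolding verts_above_Edges[OF assms] by auto
  then have "y = r" using root(2) by (auto elim: rtranclE)
  then show False using xy assms root(2) by auto
qed

text \<open>
  If one arc of the cut lay above another one, a path from the root through both arcs could be
  prolonged to a leaf and would contain two arcs of the cut.
\<close>

lemma cut_edge_not_above:
  assumes c: "Edges c \<in> Adm_tree G" and a: "(x, y) \<in> c" and a': "(x', y') \<in> c"
  shows "(y', x) \<notin> (parcs G)\<^sup>*"
proof
  assume path: "(y', x) \<in> (parcs G)\<^sup>*"
  have arcs: "(x, y) \<in> parcs G" "(x', y') \<in> parcs G"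
    and adm: "\<And>r l p. r \<in> roots G \<Longrightarrow> l \<in> leaves G \<Longrightarrow> apath r p l \<Longrightarrow> card (set p \<inter> c) \<le> 1"
    using c a a' by (auto simp: Adm_tree_def)
  note verts = arcs[THEN in_arcsD1] arcs[THEN in_arcsD2]
  obtain l where l: "l \<in> leaves G" "(y, l) \<in> (parcs G)\<^sup>*"
    using reaches_leaf[OF verts(3)] by blast
  have walk: "\<exists>p. awalk u p v" if "(u, v) \<in> (parcs G)\<^sup>*" "u \<in> pverts G" for u v
    using that reachable_iff reachable_awalk by blast
  obtain p1 p2 p3 where p: "awalk r p1 x'" "awalk y' p2 x" "awalk y p3 l"
    using walk[OF root_reaches[OF verts(2)] root(1)] walk[OF path verts(4)] walk[OF l(2) verts(3)]
    by blast
  \<comment> \<open>the walk from the root over the lower arc to the upper one and on to a leaf\<close>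
  let ?p = "p1 @ (x', y') # p2 @ (x, y) # p3"
  have "awalk r ?p l"
    using p arcs verts by (simp add: awalk_simps)
  then have "card (set ?p \<inter> c) \<le> 1"
    using root l by (intro adm walk_is_path) (auto simp: roots_def in_degree_def in_arcs_def)
  moreover have "{(x, y), (x', y')} \<subseteq> set ?p \<inter> c" using a a' by auto
  then have "card {(x, y), (x', y')} \<le> card (set ?p \<inter> c)" by (intro card_mono) auto
  \<comment> \<open>if the arcs coincided, the path from \<open>y'\<close> back to \<open>x\<close> would close a cycle\<close>
  moreover have "(x, y) \<noteq> (x', y')" using no_return[OF path] arcs by auto
  ultimately show False by simp
qed

text \<open>
  A cut consists of all the arcs that enter the region above it: none of its arcs starts in that
  region, and an arc entering it from outside ends where the region begins, so by uniqueness of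
  parents it is an arc of the cut.
\<close>

lemma boundary_verts_above:
  assumes k: "Edges c \<in> Adm_tree G"
  shows "boundary (verts_above G (Edges c)) = c"
proof -
  have c: "c \<subseteq> parcs G" using k by (auto simp: Adm_tree_def)
  show ?thesis
  proof (intro equalityI subrelI)
    fix x y assume "(x, y) \<in> c"
    then show "(x, y) \<in> boundary (verts_above G (Edges c))"
      using cut_edge_not_above[OF k] c unfolding boundary_def verts_above_Edges[OF c] by blast
  next
    fix x y assume "(x, y) \<in> boundary (verts_above G (Edges c))"
    then obtain x' y' where a: "(x, y) \<in> parcs G" "(x', y') \<in> c" "(y', y) \<in> (parcs G)\<^sup>*"
      and x: "\<not> (y', x) \<in> (parcs G)\<^sup>*"
      unfolding boundary_def verts_above_Edges[OF c] by blast
    from a(3) have "y' = y"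
      by (cases rule: rtranclE) (use parent_unique[OF a(1)] x in auto)
    then show "(x, y) \<in> c"
      using a c parent_unique[OF a(1), of x'] by auto
  qed
qed

text \<open>
  The total cut is distinguished from the others by the root, which lies above no arc. An upper set
  that contains the root is everything, and one that does not is the region above its boundary.
\<close>

lemma bij_betw_verts_above: "bij_betw (verts_above G) (Adm_tree G) (upper_sets G)"
  unfolding bij_betw_def
proof
  show "inj_on (verts_above G) (Adm_tree G)"
  proof (rule inj_onI)
    fix k k' assume k: "k \<in> Adm_tree G" "k' \<in> Adm_tree G" "verts_above G k = verts_above G k'"
    have "Edges c \<in> Adm_tree G \<Longrightarrow> verts_above G (Edges c) \<noteq> pverts G" for c
      using root_not_above[of c] root(1) by (auto simp: Adm_tree_def simp del: verts_above.simps)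
    then show "k = k'"
      using k boundary_verts_above by (cases k; cases k') (metis verts_above.simps(2))+
  qed
  show "verts_above G ` Adm_tree G = upper_sets G"
  proof (intro equalityI subsetI)
    fix U assume U: "U \<in> upper_sets G"
    show "U \<in> verts_above G ` Adm_tree G"
    proof (cases "r \<in> U")
      case True
      then show ?thesis
        using root_in_upper_set[OF U] by (auto simp: Adm_tree_def intro!: image_eqI[of _ _ Total])
    next
      case False
      then show ?thesis
        using verts_above_boundary[OF U] boundary_admissible[OF U] by (metis imageI)
    qed
  qed (auto intro: verts_above_upper_set)
qed

end

section \<open>Admissible cuts of a rooted forest\<close>

lemma parcs_mk_symmetric_pair:
  "parcs (mk_symmetric (with_proj G)) = parcs G \<union> (parcs G)\<inverse>"
  by (auto simp: mk_symmetric_def)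

context rooted_forest
begin

lemma reachable_mk_symmetric_iff:
  assumes "u \<in> pverts G"
  shows "reachable (with_proj (mk_symmetric (with_proj G))) u v \<longleftrightarrow>
    (u, v) \<in> (parcs G \<union> (parcs G)\<inverse>)\<^sup>*"
proof -
  interpret S: pair_wf_digraph "mk_symmetric (with_proj G)" ..
  show ?thesis using S.reachable_conv' assms by (simp add: parcs_mk_symmetric_pair)
qed

abbreviation connected_class :: "'a \<Rightarrow> 'a set" where
  "connected_class u \<equiv> {v. (u, v) \<in> (parcs G \<union> (parcs G)\<inverse>)\<^sup>*}"

lemma connected_class_sub: "u \<in> pverts G \<Longrightarrow> connected_class u \<subseteq> pverts G"
proof
  fix v assume "u \<in> pverts G" "v \<in> connected_class u"
  then have "(u, v) \<in> (parcs G \<union> (parcs G)\<inverse>)\<^sup>*" by simp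
  then show "v \<in> pverts G"
    using \<open>u \<in> pverts G\<close> by (induction rule: rtrancl_induct) (auto dest: in_arcsD1 in_arcsD2)
qed

lemma sym_rtrancl: "(u, v) \<in> (parcs G \<union> (parcs G)\<inverse>)\<^sup>* \<Longrightarrow> (v, u) \<in> (parcs G \<union> (parcs G)\<inverse>)\<^sup>*"
  by (rule symD[OF sym_rtrancl]) (auto intro: symI)

lemma connected_class_eq: "v \<in> connected_class u \<Longrightarrow> connected_class v = connected_class u"
  using sym_rtrancl by (auto intro: rtrancl_trans)

lemma sccs_verts_mk_symmetric:
  "pre_digraph.sccs_verts (with_proj (mk_symmetric (with_proj G))) = connected_class ` pverts G"
proof (intro equalityI subsetI)
  let ?R = "reachable (with_proj (mk_symmetric (with_proj G)))"
  fix C assume "C \<in> pre_digraph.sccs_verts (with_proj (mk_symmetric (with_proj G)))"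
  then have C: "C \<noteq> {}" "\<And>u v. u \<in> C \<Longrightarrow> v \<in> C \<Longrightarrow> ?R u v"
    "\<And>u v. u \<in> C \<Longrightarrow> v \<notin> C \<Longrightarrow> \<not> ?R u v \<or> \<not> ?R v u"
    by (auto simp: pre_digraph.sccs_verts_def)
  then obtain u where u: "u \<in> C" by blast
  have uG: "u \<in> pverts G" using C(2)[OF u u] by (auto elim: reachable_in_vertsE)
  have "C = connected_class u"
  proof (intro equalityI subsetI)
    fix v assume "v \<in> connected_class u"
    moreover from this have "v \<in> pverts G" using connected_class_sub[OF uG] by blast
    ultimately have "?R u v" "?R v u"
      using uG sym_rtrancl by (auto simp: reachable_mk_symmetric_iff)
    then show "v \<in> C" using C(3)[OF u] by blast
  next
    fix v assume "v \<in> C"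
    then show "v \<in> connected_class u"
      using C(2)[OF u] reachable_mk_symmetric_iff[OF uG] by blast
  qed
  then show "C \<in> connected_class ` pverts G" using uG by blast
next
  let ?R = "reachable (with_proj (mk_symmetric (with_proj G)))"
  fix C assume "C \<in> connected_class ` pverts G"
  then obtain u where u: "u \<in> pverts G" "C = connected_class u" by blast
  have sub: "v \<in> C \<Longrightarrow> v \<in> pverts G" for v using connected_class_sub u by blast
  have "?R v w" if "v \<in> C" "w \<in> C" for v w
    using connected_class_eq[of v u] that sub[OF that(1)] u by (auto simp: reachable_mk_symmetric_iff)
  moreover have "\<not> ?R v w" if "v \<in> C" "w \<notin> C" for v w
    using connected_class_eq[of v u] that sub[OF that(1)] u by (auto simp: reachable_mk_symmetric_iff)
  moreover have "C \<noteq> {}" using u by auto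
  ultimately show "C \<in> pre_digraph.sccs_verts (with_proj (mk_symmetric (with_proj G)))"
    by (auto simp: pre_digraph.sccs_verts_def)
qed

lemma components_eq: "components G = (\<lambda>u. pair_induce G (connected_class u)) ` pverts G"
  by (simp add: components_def sccs_verts_mk_symmetric image_image)

lemma component_closed:
  assumes "T \<in> components G" "(x, y) \<in> parcs G"
  shows "x \<in> pverts T \<longleftrightarrow> y \<in> pverts T"
  using assms by (auto simp: components_eq intro: rtrancl_into_rtrancl)

lemma component_sub: "T \<in> components G \<Longrightarrow> pverts T \<subseteq> pverts G"
  using connected_class_sub unfolding components_eq by fastforce

lemma component_eq_induce: "T \<in> components G \<Longrightarrow> T = pair_induce G (pverts T)"
  by (auto simp: components_eq)

lemma components_cover: "v \<in> pverts G \<Longrightarrow> \<exists>T\<in>components G. v \<in> pverts T"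
  by (auto simp: components_eq)

lemma components_disjoint:
  assumes "T \<in> components G" "T' \<in> components G" "v \<in> pverts T" "v \<in> pverts T'"
  shows "T = T'"
proof -
  obtain u u' where "T = pair_induce G (connected_class u)" "T' = pair_induce G (connected_class u')"
    using assms(1,2) by (auto simp: components_eq)
  moreover from this have "connected_class v = connected_class u" "connected_class v = connected_class u'"
    using assms(3,4) by (intro connected_class_eq; simp)+
  ultimately show ?thesis by simp
qed

text \<open>
  A finite acyclic component has a vertex without parent, and this vertex reaches the whole component
  by directed paths.
\<close>

lemma component_arborescence:
  assumes T: "T \<in> components G"
  shows "\<exists>r. rooted_arborescence T r"
proof -
  obtain u where u: "u \<in> pverts G" "T = pair_induce G (connected_class u)"
    using T by (auto simp: components_eq)
  have "u \<in> pverts T" using u by simp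
  then have "\<exists>r\<in>pverts T. \<forall>x. (x, r) \<notin> parcs G"
    using component_sub[OF T] component_closed[OF T] by (intro exists_root) blast+
  then obtain r where r: "r \<in> pverts T" "\<And>x. (x, r) \<notin> parcs G" by blast
  have reach: "(r, v) \<in> (parcs T)\<^sup>*" if "v \<in> pverts T" for v
  proof -
    have "connected_class r = connected_class u"
      using r u by (intro connected_class_eq) auto
    then have "(r, v) \<in> (parcs G \<union> (parcs G)\<inverse>)\<^sup>*"
      using that u by auto
    then have "(r, v) \<in> (parcs G)\<^sup>*"
      by (rule reachable_of_sym_reachable[OF single_valued_converse r(2)])
    then show ?thesis using that
    proof (induction rule: rtrancl_induct)
      case (step y z)
      then have y: "y \<in> pverts T" using component_closed[OF T] by blast
      then have "(y, z) \<in> parcs T"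
        using step by (subst component_eq_induce[OF T]) simp
      then show ?case using step.IH[OF y] by (rule rtrancl_into_rtrancl[rotated])
    qed simp
  qed
  interpret T: rooted_forest T
    using rooted_forest_pair_induce[OF component_sub[OF T]] component_eq_induce[OF T] by simp
  have "rooted_arborescence T r"
    using r reach by unfold_locales (auto simp: u(2))
  then show ?thesis by blast
qed

lemma verts_above_component:
  assumes "T \<in> components G" "k \<in> Adm_tree T"
  shows "verts_above T k \<subseteq> pverts T"
proof -
  obtain r where "rooted_arborescence T r" using component_arborescence[OF assms(1)] by blast
  then interpret T: rooted_arborescence T r .
  show ?thesis using T.verts_above_upper_set[OF assms(2)] by (rule upper_setsD(1))
qed

lemma pverts_pruning: "pverts (pruning G c) = (\<Union>T\<in>components G. verts_above T (c T))"
  by (auto simp: pruning_def pair_Union_def tree_pruning_def)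

text \<open>
  The arcs of a pruning are collected component by component; they are all the arcs between its
  vertices because no arc joins two components.
\<close>

lemma pruning_eq_induce:
  assumes "c \<in> Adm G"
  shows "pruning G c = pair_induce G (pverts (pruning G c))"
proof -
  have c: "c T \<in> Adm_tree T" if "T \<in> components G" for T
    using assms that by (auto simp: Adm_def)
  have "parcs (pruning G c) = {e \<in> parcs G. fst e \<in> pverts (pruning G c) \<and> snd e \<in> pverts (pruning G c)}"
    (is "_ = ?R")
  proof (intro equalityI subsetI)
    fix e assume "e \<in> parcs (pruning G c)"
    then obtain T where T: "T \<in> components G" "e \<in> parcs T"
      "fst e \<in> verts_above T (c T)" "snd e \<in> verts_above T (c T)"
      by (auto simp: pruning_def pair_Union_def tree_pruning_def)
    then have "e \<in> parcs G" by (auto simp: components_eq)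
    then show "e \<in> ?R" using T by (auto simp: pverts_pruning)
  next
    fix e assume "e \<in> ?R"
    then obtain T T' where T: "e \<in> parcs G" "T \<in> components G" "T' \<in> components G"
      "fst e \<in> verts_above T (c T)" "snd e \<in> verts_above T' (c T')"
      by (auto simp: pverts_pruning)
    have v: "fst e \<in> pverts T" "snd e \<in> pverts T'"
      using T verts_above_component c by blast+
    then have v': "snd e \<in> pverts T"
      using component_closed[OF T(2), of "fst e" "snd e"] T(1) by simp
    then have "T' = T" using components_disjoint T v by blast
    moreover have "e \<in> parcs T" using v(1) v' T(1) by (subst component_eq_induce[OF T(2)]) simp
    ultimately show "e \<in> parcs (pruning G c)"
      using T by (auto simp: pruning_def pair_Union_def tree_pruning_def)
  qed
  then show ?thesis by (simp add: pair_induce_def)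
qed

lemma trunk_eq_induce:
  assumes "c \<in> Adm G"
  shows "trunk G c = pair_induce G (pverts G - pverts (pruning G c))"
proof -
  have c: "c T \<in> Adm_tree T" if "T \<in> components G" for T
    using assms that by (auto simp: Adm_def)
  have iff: "v \<in> pverts G - pverts (pruning G c) \<longleftrightarrow> v \<notin> verts_above T (c T)"
    if T: "T \<in> components G" "v \<in> pverts T" for T v
  proof -
    have "T' = T" if "T' \<in> components G" "v \<in> verts_above T' (c T')" for T'
      using components_disjoint[OF that(1) T(1)] verts_above_component[OF that(1) c[OF that(1)]] that(2) T(2)
      by blast
    then show ?thesis using T component_sub[OF T(1)] unfolding pverts_pruning by blast
  qed
  have "pverts (trunk G c) = (\<Union>T\<in>components G. pverts T - verts_above T (c T))"
    by (simp add: trunk_def pair_Union_def tree_trunk_def)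
  also have "\<dots> = pverts G - pverts (pruning G c)"
  proof (intro equalityI subsetI)
    fix v assume "v \<in> (\<Union>T\<in>components G. pverts T - verts_above T (c T))"
    then show "v \<in> pverts G - pverts (pruning G c)" using iff by blast
  next
    fix v assume "v \<in> pverts G - pverts (pruning G c)"
    moreover from this obtain T where "T \<in> components G" "v \<in> pverts T"
      using components_cover by blast
    ultimately show "v \<in> (\<Union>T\<in>components G. pverts T - verts_above T (c T))" using iff by blast
  qed
  finally have verts: "pverts (trunk G c) = pverts G - pverts (pruning G c)" .
  have "parcs (trunk G c) = {e \<in> parcs G. fst e \<in> pverts G - pverts (pruning G c) \<and>
      snd e \<in> pverts G - pverts (pruning G c)}"
    (is "_ = ?R")
  proof (intro equalityI subsetI)
    fix e assume "e \<in> parcs (trunk G c)"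
    then obtain T where T: "T \<in> components G" "e \<in> parcs T"
      "fst e \<in> pverts T - verts_above T (c T)" "snd e \<in> pverts T - verts_above T (c T)"
      by (auto simp: trunk_def pair_Union_def tree_trunk_def)
    then have "e \<in> parcs G" by (auto simp: components_eq)
    then show "e \<in> ?R" using T iff[of T "fst e"] iff[of T "snd e"] by simp
  next
    fix e assume e: "e \<in> ?R"
    then obtain T where T: "T \<in> components G" "fst e \<in> pverts T"
      using components_cover by blast
    have v': "snd e \<in> pverts T"
      using component_closed[OF T(1), of "fst e" "snd e"] T(2) e by simp
    have "e \<in> parcs T" using T(2) v' e by (subst component_eq_induce[OF T(1)]) simp
    moreover have "fst e \<notin> verts_above T (c T)" "snd e \<notin> verts_above T (c T)"
      using e iff[OF T] iff[OF T(1) v'] by blast+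
    ultimately show "e \<in> parcs (trunk G c)"
      using T v' by (auto simp: trunk_def pair_Union_def tree_trunk_def)
  qed
  with verts show ?thesis by (simp add: pair_induce_def)
qed

lemma upper_set_components:
  "U \<in> upper_sets G \<longleftrightarrow> U \<subseteq> pverts G \<and> (\<forall>T\<in>components G. U \<inter> pverts T \<in> upper_sets T)"
proof (intro iffI conjI ballI)
  fix T assume "U \<in> upper_sets G" and T: "T \<in> components G"
  moreover have "parcs T \<subseteq> parcs G" using T by (auto simp: components_eq)
  moreover have "(x, y) \<in> parcs T \<Longrightarrow> y \<in> pverts T" for x y
    using T by (auto simp: components_eq)
  ultimately show "U \<inter> pverts T \<in> upper_sets T"
    unfolding upper_sets_def by blast
next
  assume U: "U \<subseteq> pverts G \<and> (\<forall>T\<in>components G. U \<inter> pverts T \<in> upper_sets T)"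
  have "y \<in> U" if xy: "(x, y) \<in> parcs G" "x \<in> U" for x y
  proof -
    obtain T where T: "T \<in> components G" "x \<in> pverts T"
      using components_cover U xy by blast
    then have "y \<in> pverts T" using component_closed xy by blast
    then have "(x, y) \<in> parcs T" using T(2) xy by (subst component_eq_induce[OF T(1)]) simp
    then show ?thesis using U T xy upper_setsD(2)[of "U \<inter> pverts T" T] by blast
  qed
  with U show "U \<in> upper_sets G" by (auto simp: upper_sets_def)
qed (auto dest: upper_setsD(1))

text \<open>
  An upper set is determined by its traces on the components, which can be chosen independently, and
  on each component upper sets correspond to cuts.
\<close>

lemma bij_betw_pruning: "bij_betw (\<lambda>c. pverts (pruning G c)) (Adm G) (upper_sets G)"
proof -
  have bij: "bij_betw (verts_above T) (Adm_tree T) (upper_sets T)" if "T \<in> components G" for T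
    using component_arborescence[OF that] by (auto intro: rooted_arborescence.bij_betw_verts_above)
  have restr: "pverts (pruning G c) \<inter> pverts T = verts_above T (c T)"
    if c: "\<And>T. T \<in> components G \<Longrightarrow> c T \<in> Adm_tree T" and T: "T \<in> components G" for c T
  proof -
    have "T' = T" if "T' \<in> components G" "v \<in> verts_above T' (c T')" "v \<in> pverts T" for T' v
      using components_disjoint[OF that(1) T] verts_above_component[OF that(1) c[OF that(1)]] that
      by blast
    then show ?thesis
      using verts_above_component[OF T c[OF T]] T unfolding pverts_pruning by blast
  qed
  show ?thesis
    unfolding bij_betw_def
  proof (intro conjI inj_onI equalityI subsetI)
    fix c c' assume c: "c \<in> Adm G" "c' \<in> Adm G" and eq: "pverts (pruning G c) = pverts (pruning G c')"
    show "c = c'"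
    proof (rule PiE_ext[OF c[unfolded Adm_def]])
      fix T assume T: "T \<in> components G"
      have "verts_above T (c T) = verts_above T (c' T)"
        using restr[of c T] restr[of c' T] c T eq by (auto simp: Adm_def PiE_iff simp del: pverts_pruning)
      then show "c T = c' T"
        using bij[OF T] c T by (auto simp: bij_betw_def Adm_def PiE_iff dest: inj_onD)
    qed
  next
    fix W assume "W \<in> (\<lambda>c. pverts (pruning G c)) ` Adm G"
    then obtain c where c: "c \<in> Adm G" "W = pverts (pruning G c)" by blast
    have cT: "c T \<in> Adm_tree T" if "T \<in> components G" for T
      using c that by (auto simp: Adm_def)
    have "W \<subseteq> pverts G"
      unfolding c(2) pverts_pruning using verts_above_component cT component_sub by blast
    moreover have "W \<inter> pverts T \<in> upper_sets T" if "T \<in> components G" for T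
      using bij[OF that] restr[OF cT that] cT[OF that] c(2) by (auto simp: bij_betw_def)
    ultimately show "W \<in> upper_sets G" using upper_set_components by blast
  next
    fix W assume W: "W \<in> upper_sets G"
    define c where "c = (\<lambda>T\<in>components G. the_inv_into (Adm_tree T) (verts_above T) (W \<inter> pverts T))"
    have Wt: "W \<inter> pverts T \<in> upper_sets T" if "T \<in> components G" for T
      using W that upper_set_components by blast
    have cT: "c T \<in> Adm_tree T" "verts_above T (c T) = W \<inter> pverts T" if T: "T \<in> components G" for T
      using bij_betw_the_inv_into[OF bij[OF T]] f_the_inv_into_f_bij_betw[OF bij[OF T]] Wt[OF T] T
      by (auto simp: c_def dest: bij_betwE)
    have "c \<in> Adm G"
      using cT(1) by (auto simp: Adm_def c_def)
    moreover have "W = pverts (pruning G c)"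
      using cT(2) upper_setsD(1)[OF W] components_cover by (force simp: pverts_pruning)
    ultimately show "W \<in> (\<lambda>c. pverts (pruning G c)) ` Adm G" by blast
  qed
qed

end

section \<open>Couples as upper sets of a rooted tree\<close>

text \<open>
  Connectedness is meant for undirected walks; uniqueness of parents makes every vertex reachable from
  the root along the arcs.
\<close>

lemma rooted_tree_root:
  assumes "rooted_tree t"
  shows "\<exists>r. rooted_arborescence t r"
proof -
  interpret pair_fin_digraph t using assms by (simp add: rooted_tree_def)
  obtain r where r: "r \<in> pverts t" "in_degree (with_proj t) r = 0"
      "\<And>v. v \<in> pverts t - {r} \<Longrightarrow> in_degree (with_proj t) v = 1"
    and conn: "connected (with_proj t)"
    using assms by (auto simp: rooted_tree_def simply_connected_def)
  have noin: "(x, r) \<notin> parcs t" for x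
    using r(2) finite_in_arcs[of r] by (auto simp: in_degree_def in_arcs_def)
  have uniq: "x = y" if "(x, v) \<in> parcs t" "(y, v) \<in> parcs t" for x y v
  proof -
    have "v \<in> pverts t - {r}" using that noin in_arcsD2 by auto
    then have "card (in_arcs (with_proj t) v) = 1" using r(3) by (simp add: in_degree_def)
    then obtain a where "in_arcs (with_proj t) v = {a}" by (auto simp: card_1_singleton_iff)
    moreover have "(x, v) \<in> in_arcs (with_proj t) v" "(y, v) \<in> in_arcs (with_proj t) v"
      using that by (auto simp: in_arcs_def)
    ultimately show ?thesis by auto
  qed
  then have sv: "single_valued ((parcs t)\<inverse>)"
    by (auto intro!: single_valuedI)
  have reach: "(r, v) \<in> (parcs t)\<^sup>*" if "v \<in> pverts t" for v
  proof -
    have "reachable (with_proj (mk_symmetric (with_proj t))) r v"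
      using conn that r(1) by (auto simp: connected_def strongly_connected_def)
    then have "(r, v) \<in> (parcs (mk_symmetric (with_proj t)))\<^sup>*"
      by (auto dest: reachable_rtranclI)
    then show ?thesis
      unfolding parcs_mk_symmetric_pair by (rule reachable_of_sym_reachable[OF sv noin])
  qed
  have "acyclic (parcs t)"
    using reach in_arcsD2 by (intro acyclic_of_root[OF sv noin]) blast
  then have "rooted_arborescence t r"
    using uniq noin reach r(1) by unfold_locales auto
  then show ?thesis by blast
qed

lemma rooted_tree_forest: "rooted_tree t \<Longrightarrow> rooted_forest t"
  using rooted_tree_root by (auto simp: rooted_arborescence_def)

lemma rooted_tree_nonempty: "rooted_tree t \<Longrightarrow> pverts t \<noteq> {}"
  by (auto simp: rooted_tree_def)

lemma is_couple_iff:
  "is_couple (t, s) \<longleftrightarrow> rooted_tree t \<and> (\<exists>U\<in>upper_sets t. s = pair_induce t U)"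
proof (cases "rooted_tree t")
  case True
  then obtain r where "rooted_arborescence t r" using rooted_tree_root by blast
  then interpret rooted_arborescence t r .
  have "upper_sets t = verts_above t ` Adm_tree t"
    using bij_betw_verts_above by (simp add: bij_betw_def)
  then show ?thesis
    using True by (simp add: is_couple_def tree_pruning_def)
qed (simp add: is_couple_def)

text \<open>
  The complement of an upper set is closed under passing to parents, so it contains the path from the
  root to each of its vertices. Undirected cycles of the trunk are cycles of the tree.
\<close>

lemma rooted_tree_trunk:
  assumes t: "rooted_tree t" and W: "W \<in> upper_sets t" "W \<noteq> pverts t"
  shows "rooted_tree (pair_induce t (pverts t - W))" (is "rooted_tree ?t'")
proof -
  obtain r where "rooted_arborescence t r" using rooted_tree_root[OF t] by blast
  then interpret t: rooted_arborescence t r .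
  interpret t': rooted_forest ?t'
    by (rule t.rooted_forest_pair_induce) auto
  have r: "r \<in> pverts t - W" using t.root_in_upper_set W t.root(1) by blast
  have reach: "(r, v) \<in> (parcs ?t')\<^sup>*" if v: "v \<in> pverts t - W" for v
  proof -
    have "(r, v) \<in> (parcs t)\<^sup>*" using t.root_reaches v by blast
    then show ?thesis using v
    proof (induction rule: rtrancl_induct)
      case (step y z)
      then have y: "y \<in> pverts t - W" using upper_setsD(2)[OF W(1)] t.in_arcsD1 by blast
      then have "(y, z) \<in> parcs ?t'" using step by simp
      then show ?case using step.IH[OF y] by (rule rtrancl_into_rtrancl[rotated])
    qed simp
  qed
  have sub: "subgraph (with_proj ?t') (with_proj t)"
    using t.wf_digraph t'.wf_digraph by (intro subgraphI) auto
  have symsub: "subgraph (with_proj (mk_symmetric (with_proj ?t'))) (with_proj (mk_symmetric (with_proj t)))"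
    using sub by (rule subgraph_mk_symmetric)
  have "connected (with_proj ?t')"
  proof -
    have *: "reachable (with_proj (mk_symmetric (with_proj ?t'))) u v"
      if "u \<in> pverts t - W" "v \<in> pverts t - W" for u v
    proof -
      have "(r, u) \<in> (parcs ?t' \<union> (parcs ?t')\<inverse>)\<^sup>*" "(r, v) \<in> (parcs ?t' \<union> (parcs ?t')\<inverse>)\<^sup>*"
        using reach[OF that(1)] reach[OF that(2)] by (blast intro: in_rtrancl_UnI)+
      then have "(u, v) \<in> (parcs ?t' \<union> (parcs ?t')\<inverse>)\<^sup>*"
        by (rule rtrancl_trans[OF t'.sym_rtrancl])
      then show ?thesis using that(1) by (subst t'.reachable_mk_symmetric_iff) auto
    qed
    show ?thesis using * r by (auto simp: connected_def strongly_connected_def)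
  qed
  moreover have "\<forall>u v. (u, v) \<in> parcs ?t' \<longrightarrow> (v, u) \<notin> parcs ?t'"
    using t by (auto simp: rooted_tree_def simply_connected_def)
  moreover have "\<not> (\<exists>p. pre_digraph.cycle (with_proj (mk_symmetric (with_proj ?t'))) p \<and> length p \<ge> 3)"
  proof
    assume "\<exists>p. pre_digraph.cycle (with_proj (mk_symmetric (with_proj ?t'))) p \<and> length p \<ge> 3"
    then obtain p u where p: "length p \<ge> 3" "p \<noteq> []"
      "pre_digraph.awalk (with_proj (mk_symmetric (with_proj ?t'))) u p u"
      "distinct (tl (pawalk_verts u p))"
      by (auto simp: pre_digraph.cycle_def awalk_verts_with_proj_eq)
    interpret S: pair_wf_digraph "mk_symmetric (with_proj t)" ..
    have "S.awalk u p u" using p(3) symsub by (rule S.subgraph_awalk_imp_awalk)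
    then have "S.cycle p" using p by (auto simp: S.cycle_def)
    then show False using t p(1) by (auto simp: rooted_tree_def simply_connected_def)
  qed
  moreover have "in_degree (with_proj ?t') r = 0"
    using t.root by (auto simp: in_degree_def in_arcs_def)
  moreover have "in_degree (with_proj ?t') v = 1" if v: "v \<in> pverts t - W - {r}" for v
  proof -
    obtain u where u: "(u, v) \<in> parcs ?t'"
      using rtranclD[OF reach[of v]] v by (blast dest: tranclD2)
    have "in_arcs (with_proj ?t') v = {(u, v)}"
    proof (intro equalityI subsetI)
      fix e assume "e \<in> in_arcs (with_proj ?t') v"
      then have "(fst e, v) \<in> parcs ?t'" "snd e = v" by (auto simp: in_arcs_def)
      then show "e \<in> {(u, v)}" using t'.parent_unique[OF _ u, of "fst e"] by (cases e) auto
    qed (use u in \<open>auto simp: in_arcs_def\<close>)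
    then show ?thesis by (simp add: in_degree_def)
  qed
  ultimately show ?thesis
    unfolding rooted_tree_def simply_connected_def using r t'.pair_fin_digraph
    by (auto intro!: bexI[of _ r])
qed

section \<open>Algebra homomorphisms of monoid algebras and their tensor products\<close>

lemma vector_space_mult: "vector_space ((*) :: 'k::field \<Rightarrow> 'k \<Rightarrow> 'k)"
  by unfold_locales (simp_all add: algebra_simps)

lemma lin_ext_eq_sum:
  assumes "vector_space scale" "finite A" "Poly_Mapping.keys x \<subseteq> A"
  shows "lin_ext scale f x = (\<Sum>i\<in>A. scale (Poly_Mapping.lookup x i) (f i))"
proof -
  interpret vector_space scale by fact
  show ?thesis
    unfolding lin_ext_def using assms(2,3)
    by (intro sum.mono_neutral_left) (auto simp: in_keys_iff)
qed

lemma lin_ext_single: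
  assumes "vector_space scale"
  shows "lin_ext scale f (Poly_Mapping.single i c) = scale c (f i)"
  using lin_ext_eq_sum[OF assms, of "{i}"] by simp

lemma lin_ext_add:
  assumes "vector_space scale"
  shows "lin_ext scale f (x + y) = lin_ext scale f x + lin_ext scale f y"
proof -
  interpret vector_space scale by fact
  let ?A = "Poly_Mapping.keys x \<union> Poly_Mapping.keys y"
  show ?thesis
    using keys_add[of x y]
    by (simp add: lin_ext_eq_sum[OF assms, of ?A] lookup_add scale_left_distrib sum.distrib)
qed

lemma lin_ext_mult:
  fixes f :: "'a::comm_monoid_add \<Rightarrow> 'v::comm_ring" and scale :: "'k::field \<Rightarrow> 'v \<Rightarrow> 'v"
  assumes "vector_space scale"
    and scale: "\<And>c d u v. scale (c * d) (u * v) = scale c u * scale d v"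
    and f: "\<And>i j. f (i + j) = f i * f j"
  shows "lin_ext scale f (x * y) = lin_ext scale f x * lin_ext scale f y"
proof (induction x rule: pm_induct)
  case (single i c)
  show ?case
    by (induction y rule: pm_induct)
      (simp_all add: mult_single lin_ext_single[OF assms(1)] lin_ext_add[OF assms(1)] distrib_left f scale)
qed (simp add: lin_ext_add[OF assms(1)] distrib_right)

lemma single_eq_pm_scale: "Poly_Mapping.single i c = pm_scale c (Poly_Mapping.single i 1)"
  by simp

lemma linear_pm_add:
  assumes "Vector_Spaces.linear pm_scale pm_scale f"
  shows "f (x + y) = f x + f y"
  using assms unfolding Vector_Spaces.linear_iff by blast

lemma linear_id_pm: "Vector_Spaces.linear pm_scale pm_scale (id :: ('a \<Rightarrow>\<^sub>0 'k::field) \<Rightarrow> _)"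
  by (simp add: Vector_Spaces.linear_iff vector_space_pm_scale)

lemma linear_pm_comp:
  fixes f :: "('a \<Rightarrow>\<^sub>0 'k::field) \<Rightarrow> ('b \<Rightarrow>\<^sub>0 'k)" and g :: "('b \<Rightarrow>\<^sub>0 'k) \<Rightarrow> ('c \<Rightarrow>\<^sub>0 'k)"
  assumes "Vector_Spaces.linear pm_scale pm_scale f" "Vector_Spaces.linear pm_scale pm_scale g"
  shows "Vector_Spaces.linear pm_scale pm_scale (\<lambda>x. g (f x))"
  using assms unfolding Vector_Spaces.linear_iff by simp

lemma pm_scale_mult: "pm_scale (c * d) (x * y) = pm_scale c x * pm_scale d y"
  for x y :: "'a::comm_monoid_add \<Rightarrow>\<^sub>0 'k::field"
proof -
  have scale: "pm_scale a z = Poly_Mapping.single 0 a * z" for a and z :: "'a \<Rightarrow>\<^sub>0 'k"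
  proof -
    interpret vector_space "pm_scale :: 'k \<Rightarrow> ('a \<Rightarrow>\<^sub>0 'k) \<Rightarrow> _" by (rule vector_space_pm_scale)
    show ?thesis
      by (induction z rule: pm_induct) (simp_all add: mult_single scale_right_distrib distrib_left)
  qed
  show ?thesis
    by (simp add: scale mult_single[of 0 c 0 d, simplified, symmetric] mult_ac)
qed

lemma pm_scale_add: "pm_scale c (x + y) = pm_scale c x + pm_scale c y"
  and pm_scale_pm_scale: "pm_scale c (pm_scale d x) = pm_scale (c * d) x"
  and pm_scale_one: "pm_scale 1 x = x"
  by (auto intro!: poly_mapping_eqI simp: lookup_add distrib_left)

lemma tensor_pm_scale:
  "tensor (pm_scale c x) y = pm_scale c (tensor x y)" "tensor x (pm_scale c y) = pm_scale c (tensor x y)"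
  by (auto intro!: poly_mapping_eqI)

lemma tensor_sum: "tensor (sum f A) y = (\<Sum>i\<in>A. tensor (f i) y)"
  "tensor x (sum g B) = (\<Sum>j\<in>B. tensor x (g j))"
  by (auto intro!: poly_mapping_eqI simp: lookup_sum sum_distrib_left sum_distrib_right)

lemma tensor_lift_single:
  "tensor_lift B (Poly_Mapping.single (i, j) c) =
    pm_scale c (B (Poly_Mapping.single i 1) (Poly_Mapping.single j 1))"
  by (simp add: tensor_lift_def lin_ext_single[OF vector_space_pm_scale])

lemma tensor_lift_add: "tensor_lift B (u + v) = tensor_lift B u + tensor_lift B v"
  by (rule linear_pm_add[OF linear_tensor_lift])

text \<open>
  Unital algebra homomorphisms between monoid algebras of commutative monoids. Products of such
  monoids give the tensor products of these algebras.
\<close>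

definition algebra_hom ::
  "(('a::comm_monoid_add \<Rightarrow>\<^sub>0 'k::field) \<Rightarrow> ('b::comm_monoid_add \<Rightarrow>\<^sub>0 'k)) \<Rightarrow> bool" where
  "algebra_hom F \<longleftrightarrow> Vector_Spaces.linear pm_scale pm_scale F \<and> F 1 = 1 \<and> (\<forall>x y. F (x * y) = F x * F y)"

lemma algebra_homD:
  assumes "algebra_hom F"
  shows "Vector_Spaces.linear pm_scale pm_scale F" "F 1 = 1" "F (x * y) = F x * F y"
  using assms by (auto simp: algebra_hom_def)

lemma algebra_hom_id: "algebra_hom id"
  by (simp add: algebra_hom_def linear_id_pm)

lemma algebra_hom_comp: "algebra_hom F \<Longrightarrow> algebra_hom G \<Longrightarrow> algebra_hom (\<lambda>x. G (F x))"
  by (simp add: algebra_hom_def linear_pm_comp)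

text \<open>
  The algebra with basis the multisets over a set is the free commutative algebra on this set.
\<close>

lemma algebra_hom_eq:
  fixes F G :: "('a multiset \<Rightarrow>\<^sub>0 'k::field) \<Rightarrow> ('b::comm_monoid_add \<Rightarrow>\<^sub>0 'k)"
  assumes F: "algebra_hom F" and G: "algebra_hom G"
    and gen: "\<And>x. F (Poly_Mapping.single {#x#} 1) = G (Poly_Mapping.single {#x#} 1)"
  shows "F u = G u"
proof -
  have mono: "F (Poly_Mapping.single M 1) = G (Poly_Mapping.single M 1)" for M
  proof (induction M)
    case empty
    then show ?case using algebra_homD(2)[OF F] algebra_homD(2)[OF G] by (simp flip: zero_multiset_def)
  next
    case (add x M)
    have "Poly_Mapping.single (add_mset x M) (1::'k) =
        Poly_Mapping.single {#x#} 1 * Poly_Mapping.single M 1"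
      by (simp add: mult_single)
    then show ?case
      by (simp only: algebra_homD(3)[OF F] algebra_homD(3)[OF G] gen add)
  qed
  show ?thesis
  proof (induction u rule: pm_induct)
    case (single i c)
    then show ?case
      using mono by (subst (1 2) single_eq_pm_scale)
        (simp only: linear_pm_scale[OF algebra_homD(1)[OF F]] linear_pm_scale[OF algebra_homD(1)[OF G]])
  qed (simp add: linear_pm_add[OF algebra_homD(1)[OF F]] linear_pm_add[OF algebra_homD(1)[OF G]])
qed

lemma one_tensor: "(1 :: 'a::comm_monoid_add \<times> 'b::comm_monoid_add \<Rightarrow>\<^sub>0 'k::field) = tensor 1 1"
  by (simp add: tensor_single zero_prod_def flip: single_one)

lemma algebra_hom_tensor_lift:
  fixes B :: "('a::comm_monoid_add \<Rightarrow>\<^sub>0 'k::field) \<Rightarrow> ('b::comm_monoid_add \<Rightarrow>\<^sub>0 'k) \<Rightarrow> ('c::comm_monoid_add \<Rightarrow>\<^sub>0 'k)"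
  assumes "B 1 1 = 1" and "\<And>x x' y y'. B (x * x') (y * y') = B x y * B x' y'"
  shows "algebra_hom (tensor_lift B)"
proof -
  have "tensor_lift B (u * v) = tensor_lift B u * tensor_lift B v" for u v
    unfolding tensor_lift_def
  proof (rule lin_ext_mult[OF vector_space_pm_scale pm_scale_mult])
    fix p q :: "'a \<times> 'b"
    show "(case p + q of (i, j) \<Rightarrow> B (Poly_Mapping.single i 1) (Poly_Mapping.single j 1)) =
        (case p of (i, j) \<Rightarrow> B (Poly_Mapping.single i 1) (Poly_Mapping.single j 1)) *
        (case q of (i, j) \<Rightarrow> B (Poly_Mapping.single i 1) (Poly_Mapping.single j 1))"
      by (cases p; cases q) (simp add: mult_single flip: assms(2))
  qed
  moreover have "(1 :: 'a \<times> 'b \<Rightarrow>\<^sub>0 'k) = Poly_Mapping.single (0, 0) 1"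
    by (metis single_one zero_prod_def)
  then have "tensor_lift B 1 = tensor_lift B (Poly_Mapping.single (0, 0) 1)"
    by (rule arg_cong)
  then have "tensor_lift B 1 = 1"
    using assms(1) by (simp add: tensor_lift_single pm_scale_one)
  ultimately show ?thesis by (simp add: algebra_hom_def linear_tensor_lift)
qed

lemma algebra_hom_tensor_map:
  assumes "algebra_hom f" "algebra_hom g"
  shows "algebra_hom (tensor_map f g)"
  unfolding tensor_map_def
  by (rule algebra_hom_tensor_lift)
    (simp_all add: algebra_homD[OF assms(1)] algebra_homD[OF assms(2)] one_tensor tensor_mult)

lemma tensor_map_tensor:
  assumes f: "Vector_Spaces.linear pm_scale pm_scale f" and g: "Vector_Spaces.linear pm_scale pm_scale g"
  shows "tensor_map f g (tensor x y) = tensor (f x) (g y)"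
  unfolding tensor_map_def
proof (rule tensor_lift_tensor)
  show "bilinear_pm (\<lambda>x y. tensor (f x) (g y))"
    by (simp add: bilinear_pm_def Vector_Spaces.linear_iff vector_space_pm_scale linear_pm_add[OF f]
        linear_pm_add[OF g] linear_pm_scale[OF f] linear_pm_scale[OF g] tensor_add_left tensor_add_right
        tensor_pm_scale)
qed

lemma bilinear_tensor_assoc: "bilinear_pm (\<lambda>x y. tensor x (tensor y z))"
  by (simp add: bilinear_pm_def Vector_Spaces.linear_iff vector_space_pm_scale tensor_add_left
      tensor_add_right tensor_pm_scale)

lemma tensor_assoc_tensor:
  fixes x :: "'a \<Rightarrow>\<^sub>0 'k::field" and y :: "'b \<Rightarrow>\<^sub>0 'k" and z :: "'c \<Rightarrow>\<^sub>0 'k"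
  shows "tensor_assoc (tensor (tensor x y) z) = tensor x (tensor y z)"
proof -
  let ?L = "\<lambda>(z :: 'c \<Rightarrow>\<^sub>0 'k) (u :: 'a \<times> 'b \<Rightarrow>\<^sub>0 'k). tensor_lift (\<lambda>x y. tensor x (tensor y z)) u"
  have "?L (z + z') u = ?L z u + ?L z' u" for z z' u
    by (induction u rule: pm_induct)
      (auto simp: tensor_lift_single tensor_lift_add tensor_add_right pm_scale_add)
  moreover have "?L (pm_scale c z) u = pm_scale c (?L z u)" for c z u
    by (induction u rule: pm_induct)
      (auto simp: tensor_lift_single tensor_lift_add tensor_pm_scale pm_scale_add pm_scale_pm_scale mult.commute)
  ultimately have "bilinear_pm (\<lambda>u z. ?L z u)"
    by (simp add: bilinear_pm_def Vector_Spaces.linear_iff vector_space_pm_scale tensor_lift_add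
        linear_pm_scale[OF linear_tensor_lift])
  then show ?thesis
    unfolding tensor_assoc_def
    by (simp add: tensor_lift_tensor tensor_lift_tensor[OF bilinear_tensor_assoc])
qed

text \<open>
  The product of the tensor square is the convolution product over the monoid \<open>'a \<times> 'a\<close>.
\<close>

lemma tensor_mul_mult:
  fixes u v :: "'a::comm_monoid_add \<times> 'a \<Rightarrow>\<^sub>0 'k::field"
  shows "tensor_mul (*) u v = u * v"
proof (induction u rule: pm_induct)
  case (single p c)
  obtain i j where p: "p = (i, j)" by (cases p)
  show ?case
  proof (induction v rule: pm_induct)
    case (single q d)
    obtain i' j' where q: "q = (i', j')" by (cases q)
    show ?case
      by (simp add: p q tensor_mul_def tensor_lift_single mult_single tensor_single)
  next
    case (add v w)
    from add show ?case
      by (simp add: p tensor_mul_def tensor_lift_single tensor_lift_add distrib_left pm_scale_add)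
  qed
qed (simp add: tensor_mul_def tensor_lift_add distrib_right)

lemma algebra_hom_tensor_assoc:
  "algebra_hom (tensor_assoc :: (('a::comm_monoid_add \<times> 'b::comm_monoid_add) \<times> 'c::comm_monoid_add \<Rightarrow>\<^sub>0 'k::field) \<Rightarrow> _)"
proof -
  have one: "tensor_lift (\<lambda>x y. tensor x (tensor y (1 :: 'c \<Rightarrow>\<^sub>0 'k))) (1 :: 'a \<times> 'b \<Rightarrow>\<^sub>0 'k) = 1"
    by (simp add: one_tensor tensor_lift_tensor[OF bilinear_tensor_assoc])
  have mult: "tensor_lift (\<lambda>x y. tensor x (tensor y (z * z'))) (u * v) =
    tensor_lift (\<lambda>x y. tensor x (tensor y z)) u * tensor_lift (\<lambda>x y. tensor x (tensor y z')) v"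
    for u v :: "'a \<times> 'b \<Rightarrow>\<^sub>0 'k" and z z' :: "'c \<Rightarrow>\<^sub>0 'k"
  proof (induction u rule: pm_induct)
    case (single p c)
    show ?case
    proof (induction v rule: pm_induct)
      case (single q d)
      show ?case
        by (cases p; cases q)
          (simp add: mult_single tensor_lift_single tensor_mult flip: pm_scale_mult)
    qed (simp add: tensor_lift_add distrib_left)
  qed (simp add: tensor_lift_add distrib_right)
  show ?thesis
    unfolding tensor_assoc_def by (rule algebra_hom_tensor_lift) (simp_all add: one mult)
qed

section \<open>The coproduct on isomorphism classes\<close>

lemma upper_set_Diff_trunk:
  assumes "U \<in> upper_sets t" "W \<in> upper_sets t"
  shows "U - W \<in> upper_sets (pair_induce t (pverts t - W))"
  using upper_setsD[OF assms(1)] by (auto simp: upper_sets_def)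

definition graph_image :: "('a \<Rightarrow> 'b) \<Rightarrow> 'a pair_pre_digraph \<Rightarrow> 'b pair_pre_digraph" where
  "graph_image f G = \<lparr> pverts = f ` pverts G, parcs = map_prod f f ` parcs G \<rparr>"

lemma graph_image_simps [simp]:
  "pverts (graph_image f G) = f ` pverts G" "parcs (graph_image f G) = map_prod f f ` parcs G"
  by (simp_all add: graph_image_def)

lemma graph_image_pair_induce:
  assumes "inj_on f (pverts G)" "parcs G \<subseteq> pverts G \<times> pverts G" "S \<subseteq> pverts G"
  shows "graph_image f (pair_induce G S) = pair_induce (graph_image f G) (f ` S)"
proof -
  have iff: "f v \<in> f ` S \<longleftrightarrow> v \<in> S" if "v \<in> pverts G" for v
    using assms(1) that assms(3) by (rule inj_on_image_mem_iff)
  have "map_prod f f ` {e \<in> parcs G. fst e \<in> S \<and> snd e \<in> S} =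
      {e \<in> map_prod f f ` parcs G. fst e \<in> f ` S \<and> snd e \<in> f ` S}"
  proof (intro equalityI subsetI)
    fix e assume "e \<in> {e \<in> map_prod f f ` parcs G. fst e \<in> f ` S \<and> snd e \<in> f ` S}"
    then obtain x y where xy: "(x, y) \<in> parcs G" "e = (f x, f y)" "f x \<in> f ` S" "f y \<in> f ` S"
      by auto
    then have "x \<in> S" "y \<in> S" using iff assms(2) by auto
    then show "e \<in> map_prod f f ` {e \<in> parcs G. fst e \<in> S \<and> snd e \<in> S}"
      using xy by (auto intro!: image_eqI[of _ _ "(x, y)"])
  qed auto
  then show ?thesis by (simp add: graph_image_def pair_induce_def)
qed

lemma upper_sets_graph_image:
  assumes inj: "inj_on f (pverts G)" and sub: "parcs G \<subseteq> pverts G \<times> pverts G"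
  shows "upper_sets (graph_image f G) = (`) f ` upper_sets G"
proof (intro equalityI subsetI)
  have iff: "f v \<in> f ` S \<longleftrightarrow> v \<in> S" if "v \<in> pverts G" "S \<subseteq> pverts G" for v S
    using inj that by (rule inj_on_image_mem_iff)
  { fix W assume "W \<in> upper_sets (graph_image f G)"
    then have W: "W \<subseteq> f ` pverts G" "\<And>x y. (x, y) \<in> parcs G \<Longrightarrow> f x \<in> W \<Longrightarrow> f y \<in> W"
      by (auto simp: upper_sets_def)
    define U where "U = {v \<in> pverts G. f v \<in> W}"
    have "W = f ` U" using W(1) by (auto simp: U_def)
    moreover have "U \<in> upper_sets G" using W(2) sub by (auto simp: U_def upper_sets_def)
    ultimately show "W \<in> (`) f ` upper_sets G" by blast }
  { fix W assume "W \<in> (`) f ` upper_sets G"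
    then obtain U where U: "U \<in> upper_sets G" "W = f ` U" by blast
    have "f y \<in> f ` U" if "(x, y) \<in> parcs G" "f x \<in> f ` U" for x y
    proof -
      have "x \<in> pverts G" using that(1) sub by blast
      then have "x \<in> U" using that(2) iff upper_setsD(1)[OF U(1)] by blast
      then show ?thesis using upper_setsD(2)[OF U(1) that(1)] by blast
    qed
    then show "W \<in> upper_sets (graph_image f G)"
      using upper_setsD(1)[OF U(1)] by (auto simp: upper_sets_def U(2)) }
qed

lemma couple_iso_graph_image:
  "couple_iso (t, s) (t', s') \<longleftrightarrow> is_couple (t, s) \<and> is_couple (t', s') \<and>
     (\<exists>f. inj_on f (pverts t) \<and> t' = graph_image f t \<and> s' = graph_image f s)"
  by (auto simp: couple_iso_iff graph_image_def)

lemma abs_couple_eq: "couple_iso x y \<Longrightarrow> abs_couple x = abs_couple y"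
  using Quotient3_rel[OF Quotient3_couple] by metis

lemma rep_couple_iso: "is_couple x \<Longrightarrow> couple_iso (rep_couple (abs_couple x)) x"
  using Quotient3_rep_abs[OF Quotient3_couple] couple_iso_refl by blast

lemma is_couple_rep: "is_couple (rep_couple x)"
  using Quotient3_rep_reflp[OF Quotient3_couple, of x] by (cases "rep_couple x") (auto simp: couple_iso_iff)

lemma abs_rep_couple: "abs_couple (rep_couple x) = x"
  using Quotient3_abs_rep[OF Quotient3_couple] by metis

text \<open>
  The couple \<open>(t, t[U])\<close>: for a fixed tree, couples are parametrized by upper sets.
\<close>

definition upper_set_elem :: "nat pair_pre_digraph \<Rightarrow> nat set \<Rightarrow> 'k::field doubled" where
  "upper_set_elem t U = couple_elem t (pair_induce t U)"

abbreviation remove_verts :: "'a pair_pre_digraph \<Rightarrow> 'a set \<Rightarrow> 'a pair_pre_digraph" where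
  "remove_verts t W \<equiv> pair_induce t (pverts t - W)"

text \<open>
  The empty graph has to be allowed because it is the trunk of the total cut of a tree. Its couple is
  the unit, for which the formulas below hold as well.
\<close>

definition tree_or_empty :: "'a pair_pre_digraph \<Rightarrow> bool" where
  "tree_or_empty t \<longleftrightarrow> rooted_tree t \<or> pverts t = {} \<and> parcs t = {}"

lemma tree_or_empty_wf: "tree_or_empty t \<Longrightarrow> parcs t \<subseteq> pverts t \<times> pverts t"
  using is_couple_subset(3)[of t "pair_induce t {}"] empty_upper_set[of t]
  unfolding tree_or_empty_def is_couple_iff by blast

lemma tree_or_empty_finite: "tree_or_empty t \<Longrightarrow> finite (pverts t)"
  by (auto simp: tree_or_empty_def rooted_tree_def pair_fin_digraph_def pair_fin_digraph_axioms_def)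

lemma tree_or_empty_remove_verts:
  assumes "tree_or_empty t" "W \<in> upper_sets t"
  shows "tree_or_empty (remove_verts t W)"
proof (cases "W = pverts t")
  case False
  then show ?thesis
    using assms rooted_tree_trunk[of t W] upper_setsD(1)[OF assms(2)] by (auto simp: tree_or_empty_def)
qed (simp add: tree_or_empty_def)

lemma finite_upper_sets: "tree_or_empty t \<Longrightarrow> finite (upper_sets t)"
  using tree_or_empty_finite[of t] by (auto simp: upper_sets_def)

text \<open>
  If \<open>t\<close> is empty, both sides are the unit; otherwise \<open>f\<close> is an isomorphism of couples.
\<close>

lemma upper_set_elem_graph_image:
  assumes "tree_or_empty t" "tree_or_empty (graph_image f t)" "inj_on f (pverts t)" "U \<in> upper_sets t"
  shows "upper_set_elem (graph_image f t) (f ` U) = upper_set_elem t U"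
proof (cases "pverts t = {}")
  case True
  then show ?thesis by (simp add: upper_set_elem_def couple_elem_def)
next
  case False
  then have t: "rooted_tree t" "rooted_tree (graph_image f t)"
    using assms by (auto simp: tree_or_empty_def)
  note wf = tree_or_empty_wf[OF assms(1)]
  have U': "f ` U \<in> upper_sets (graph_image f t)"
    using assms upper_sets_graph_image[OF assms(3) wf] by blast
  have "couple_iso (t, pair_induce t U) (graph_image f t, pair_induce (graph_image f t) (f ` U))"
    unfolding couple_iso_graph_image is_couple_iff
    using t U' assms(3,4) graph_image_pair_induce[OF assms(3) wf upper_setsD(1)[OF assms(4)]]
    by auto
  then show ?thesis
    using False abs_couple_eq by (simp add: upper_set_elem_def couple_elem_def)
qed

text \<open>
  The sum over the cuts of \<open>t[U]\<close> is reindexed by their regions. These are the upper sets of \<open>t\<close> that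
  are contained in \<open>U\<close>.
\<close>

lemma couple_coprod_upper_sets:
  assumes "is_couple (t, pair_induce t U)" "U \<in> upper_sets t"
  shows "couple_coprod t (pair_induce t U) =
    (\<Sum>W | W \<in> upper_sets t \<and> W \<subseteq> U. tensor (upper_set_elem t W) (upper_set_elem (remove_verts t W) (U - W)))"
proof -
  let ?s = "pair_induce t U"
  have t: "rooted_tree t" using assms(1) by (simp add: is_couple_iff)
  note U = upper_setsD(1)[OF assms(2)]
  interpret t: rooted_forest t using rooted_tree_forest[OF t] .
  interpret s: rooted_forest ?s using U by (rule t.rooted_forest_pair_induce)
  have "couple_coprod t ?s = (\<Sum>c\<in>Adm ?s.
      tensor (upper_set_elem t (pverts (pruning ?s c)))
        (upper_set_elem (remove_verts t (pverts (pruning ?s c))) (U - pverts (pruning ?s c))))"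
    unfolding couple_coprod_def
  proof (intro sum.cong refl)
    fix c assume c: "c \<in> Adm ?s"
    have sub: "pverts (pruning ?s c) \<subseteq> U"
      using upper_setsD(1)[OF bij_betwE[OF s.bij_betw_pruning, rule_format, OF c]] by simp
    have "pruning ?s c = pair_induce t (pverts (pruning ?s c))"
      by (subst s.pruning_eq_induce[OF c]) (simp add: sub)
    moreover have "trunk ?s c = pair_induce (remove_verts t (pverts (pruning ?s c))) (U - pverts (pruning ?s c))"
      using U by (subst s.trunk_eq_induce[OF c]) (simp add: Diff_mono)
    ultimately show "tensor (couple_elem t (pruning ?s c)) (couple_elem (ambient_trunk t ?s c) (trunk ?s c)) =
        tensor (upper_set_elem t (pverts (pruning ?s c)))
        (upper_set_elem (remove_verts t (pverts (pruning ?s c))) (U - pverts (pruning ?s c)))"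
      by (simp add: upper_set_elem_def ambient_trunk_def)
  qed
  also have "\<dots> = (\<Sum>W\<in>upper_sets ?s. tensor (upper_set_elem t W) (upper_set_elem (remove_verts t W) (U - W)))"
    by (rule sum.reindex_bij_betw[OF s.bij_betw_pruning])
  finally show ?thesis by (simp add: upper_sets_pair_induce[OF assms(2)])
qed

text \<open>
  An isomorphism maps the upper sets inside \<open>U\<close> bijectively to those inside its image and each
  summand to the corresponding one.
\<close>

lemma couple_coprod_iso:
  assumes "couple_iso (t, s) (t', s')"
  shows "couple_coprod t s = (couple_coprod t' s' :: 'k::field doubled2)"
proof -
  obtain f where c: "is_couple (t, s)" "is_couple (t', s')" and f: "inj_on f (pverts t)"
    and t': "t' = graph_image f t" and s': "s' = graph_image f s"
    using assms by (auto simp: couple_iso_graph_image)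
  obtain U where t: "rooted_tree t" and U: "U \<in> upper_sets t" "s = pair_induce t U"
    using c(1) by (auto simp: is_couple_iff)
  have rt': "rooted_tree t'" using c(2) by (simp add: is_couple_iff)
  have te: "tree_or_empty t" "tree_or_empty t'" using t rt' by (auto simp: tree_or_empty_def)
  note wf = tree_or_empty_wf[OF te(1)]
  note ups = upper_sets_graph_image[OF f wf, folded t']
  note sub = upper_setsD(1)[OF U(1)]
  have U': "f ` U \<in> upper_sets t'" using ups U by blast
  have s'U: "s' = pair_induce t' (f ` U)"
    using graph_image_pair_induce[OF f wf sub] by (simp add: s' t' U(2))
  have inj: "inj_on ((`) f) (Pow (pverts t))"
    using f by (rule inj_on_image_Pow)
  have image_diff: "f ` (A - W) = f ` A - f ` W" if "A \<subseteq> pverts t" "W \<subseteq> pverts t" for A W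
    using inj_on_image_set_diff[OF f, of A W] that by blast
  have "(\<Sum>W | W \<in> upper_sets t' \<and> W \<subseteq> f ` U. tensor (upper_set_elem t' W :: 'k doubled) (upper_set_elem (remove_verts t' W) (f ` U - W)))
     = (\<Sum>W | W \<in> upper_sets t \<and> W \<subseteq> U. tensor (upper_set_elem t' (f ` W)) (upper_set_elem (remove_verts t' (f ` W)) (f ` U - f ` W)))"
  proof (rule sum.reindex_cong)
    show "inj_on ((`) f) {W \<in> upper_sets t. W \<subseteq> U}"
      by (rule inj_on_subset[OF inj]) (auto dest: upper_setsD(1))
    have "W \<subseteq> U" if "W \<in> upper_sets t" "f ` W \<subseteq> f ` U" for W
      using inj_on_image_mem_iff[OF f _ sub] upper_setsD(1)[OF that(1)] that(2) by blast
    then show "{W \<in> upper_sets t'. W \<subseteq> f ` U} = (`) f ` {W \<in> upper_sets t. W \<subseteq> U}"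
      unfolding ups by blast
  qed simp
  also have "\<dots> = (\<Sum>W | W \<in> upper_sets t \<and> W \<subseteq> U. tensor (upper_set_elem t W) (upper_set_elem (remove_verts t W) (U - W)))"
  proof (intro sum.cong refl)
    fix W assume "W \<in> {W \<in> upper_sets t. W \<subseteq> U}"
    then have W: "W \<in> upper_sets t" "W \<subseteq> U" by auto
    note Wsub = upper_setsD(1)[OF W(1)]
    have W': "f ` W \<in> upper_sets t'" using ups W by blast
    have rem: "remove_verts t' (f ` W) = graph_image f (remove_verts t W)"
      using graph_image_pair_induce[OF f wf, of "pverts t - W"] image_diff[OF order_refl Wsub] by (simp add: t')
    have "upper_set_elem t' (f ` W) = (upper_set_elem t W :: 'k doubled)"
      using upper_set_elem_graph_image[of t f W] te f W t' by simp
    moreover have "upper_set_elem (graph_image f (remove_verts t W)) (f ` (U - W)) =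
        (upper_set_elem (remove_verts t W) (U - W) :: 'k doubled)"
    proof (rule upper_set_elem_graph_image)
      show "tree_or_empty (remove_verts t W)" using te(1) W(1) by (rule tree_or_empty_remove_verts)
      show "tree_or_empty (graph_image f (remove_verts t W))"
        using tree_or_empty_remove_verts[OF te(2) W'] by (simp add: rem)
      show "inj_on f (pverts (remove_verts t W))" using f by (rule inj_on_subset) auto
      show "U - W \<in> upper_sets (remove_verts t W)"
        using U(1) W(1) by (rule upper_set_Diff_trunk)
    qed
    ultimately show "tensor (upper_set_elem t' (f ` W) :: 'k doubled) (upper_set_elem (remove_verts t' (f ` W)) (f ` U - f ` W)) =
        tensor (upper_set_elem t W) (upper_set_elem (remove_verts t W) (U - W))"
      by (simp add: rem image_diff[OF sub Wsub])
  qed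
  finally show ?thesis
    using c U U' s'U by (simp add: couple_coprod_upper_sets)
qed

section \<open>The bialgebra laws\<close>

lemma doubled_coprod_single:
  "doubled_coprod (Poly_Mapping.single M c :: 'k::field doubled) = pm_scale c
     (\<Prod>x\<in>#M. couple_coprod (fst (rep_couple x)) (snd (rep_couple x)))"
  by (simp add: doubled_coprod_def lin_ext_single[OF vector_space_pm_scale])

lemma algebra_hom_doubled_coprod: "algebra_hom (doubled_coprod :: 'k::field doubled \<Rightarrow> _)"
  unfolding algebra_hom_def
proof (intro conjI allI)
  show "Vector_Spaces.linear pm_scale pm_scale (doubled_coprod :: 'k doubled \<Rightarrow> _)"
    unfolding doubled_coprod_def by (rule linear_lin_ext)
  show "doubled_coprod (1 :: 'k doubled) = 1"
    using doubled_coprod_single[of 0 1] by (simp add: pm_scale_one)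
  show "doubled_coprod (x * y) = doubled_coprod x * doubled_coprod y" for x y :: "'k doubled"
    unfolding doubled_coprod_def by (rule lin_ext_mult[OF vector_space_pm_scale pm_scale_mult]) simp
qed

lemma doubled_coprod_couple_elem:
  assumes "is_couple (t, s)"
  shows "doubled_coprod (couple_elem t s) = couple_coprod t s"
proof -
  have "pverts t \<noteq> {}" using assms by (auto simp: is_couple_iff dest: rooted_tree_nonempty)
  moreover obtain t' s' where r: "rep_couple (abs_couple (t, s)) = (t', s')"
    by (cases "rep_couple (abs_couple (t, s))")
  then have "couple_coprod t' s' = couple_coprod t s"
    using rep_couple_iso[OF assms] by (auto intro: couple_coprod_iso)
  ultimately show ?thesis
    by (simp add: couple_elem_def doubled_coprod_single pm_scale_one r)
qed

text \<open>
  Allowing empty \<open>t\<close> makes the formula applicable to both factors of each of its own summands.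
\<close>

lemma doubled_coprod_upper_set_elem:
  assumes "tree_or_empty t" "U \<in> upper_sets t"
  shows "doubled_coprod (upper_set_elem t U) =
    (\<Sum>W | W \<in> upper_sets t \<and> W \<subseteq> U. tensor (upper_set_elem t W) (upper_set_elem (remove_verts t W) (U - W)))"
proof (cases "pverts t = {}")
  case True
  then have "{W \<in> upper_sets t. W \<subseteq> U} = {{}}"
    using upper_setsD(1) assms(2) by auto
  with True show ?thesis
    by (simp add: upper_set_elem_def couple_elem_def algebra_homD(2)[OF algebra_hom_doubled_coprod] flip: one_tensor)
next
  case False
  then have c: "is_couple (t, pair_induce t U)"
    using assms by (auto simp: tree_or_empty_def is_couple_iff)
  show ?thesis
    unfolding upper_set_elem_def[of t U] doubled_coprod_couple_elem[OF c]
    by (rule couple_coprod_upper_sets[OF c assms(2)])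
qed

lemma generator_upper_set_elem:
  obtains t U where "rooted_tree t" "U \<in> upper_sets t" "Poly_Mapping.single {#x#} 1 = upper_set_elem t U"
proof -
  obtain t s where ts: "rep_couple x = (t, s)" by (cases "rep_couple x")
  then have "is_couple (t, s)" using is_couple_rep[of x] by simp
  then obtain U where U: "rooted_tree t" "U \<in> upper_sets t" "s = pair_induce t U"
    by (auto simp: is_couple_iff)
  moreover have "abs_couple (t, s) = x" using abs_rep_couple[of x] ts by simp
  ultimately show ?thesis
    using rooted_tree_nonempty[OF U(1)] that[of t U] by (simp add: upper_set_elem_def couple_elem_def)
qed

text \<open>
  Both sides are algebra homomorphisms. On a couple \<open>(t, t[U])\<close> the left side is a sum over chains
  \<open>X \<subseteq> W \<subseteq> U\<close>, the right side a sum over \<open>X\<close> and an upper set \<open>Y\<close> of the trunk \<open>t[V - X]\<close>. The summands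
  agree for \<open>W = X \<union> Y\<close>.
\<close>

lemma doubled_coassoc:
  "tensor_assoc (tensor_map doubled_coprod id (doubled_coprod x)) =
   tensor_map id doubled_coprod (doubled_coprod (x :: 'k::field doubled))"
proof (rule algebra_hom_eq[where F = "\<lambda>x. tensor_assoc (tensor_map doubled_coprod id (doubled_coprod x))"
      and G = "\<lambda>x. tensor_map id doubled_coprod (doubled_coprod x)"])
  note hom = algebra_hom_doubled_coprod[where 'k = 'k]
  note lin = algebra_homD(1)[OF hom]
  show "algebra_hom (\<lambda>x. tensor_assoc (tensor_map doubled_coprod id (doubled_coprod (x :: 'k doubled))))"
    by (rule algebra_hom_comp[OF algebra_hom_comp[OF hom algebra_hom_tensor_map[OF hom algebra_hom_id]]
          algebra_hom_tensor_assoc])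
  show "algebra_hom (\<lambda>x. tensor_map id doubled_coprod (doubled_coprod (x :: 'k doubled)))"
    by (rule algebra_hom_comp[OF hom algebra_hom_tensor_map[OF algebra_hom_id hom]])
  fix x :: couple
  obtain t U where t: "rooted_tree t" and U: "U \<in> upper_sets t"
    and x: "Poly_Mapping.single {#x#} 1 = (upper_set_elem t U :: 'k doubled)"
    by (rule generator_upper_set_elem)
  have te: "tree_or_empty t" using t by (simp add: tree_or_empty_def)
  note wf = tree_or_empty_wf[OF te]
  note Usub = upper_setsD(1)[OF U]
  let ?A = "{W \<in> upper_sets t. W \<subseteq> U}"
  let ?B = "\<lambda>X. {Y \<in> upper_sets (remove_verts t X). Y \<subseteq> U - X}"
  let ?f = "\<lambda>W X. tensor (upper_set_elem t X) (tensor (upper_set_elem (remove_verts t X) (W - X))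
      (upper_set_elem (remove_verts t W) (U - W)))"
  have fin: "finite ?A" using finite_upper_sets[OF te] by simp
  have finB: "finite (?B X)" if "X \<in> upper_sets t" for X
    using finite_upper_sets[OF tree_or_empty_remove_verts[OF te that]] by simp
  have upB: "Y \<in> ?B X \<longleftrightarrow> Y \<subseteq> U - X \<and> X \<union> Y \<in> upper_sets t" if "X \<in> upper_sets t" for X Y
    using upper_sets_trunk[OF that] wf Usub by auto
  have "tensor_assoc (tensor_map doubled_coprod id (doubled_coprod (upper_set_elem t U :: 'k doubled))) =
      (\<Sum>W\<in>?A. tensor_assoc (tensor (doubled_coprod (upper_set_elem t W))
        (upper_set_elem (remove_verts t W) (U - W))))"
    by (simp add: doubled_coprod_upper_set_elem[OF te U] tensor_map_tensor[OF lin linear_id_pm]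
        linear_pm_sum[OF algebra_homD(1)[OF algebra_hom_tensor_map[OF hom algebra_hom_id]]]
        linear_pm_sum[OF algebra_homD(1)[OF algebra_hom_tensor_assoc]])
  also have "\<dots> = (\<Sum>W\<in>?A. \<Sum>X | X \<in> upper_sets t \<and> X \<subseteq> W. ?f W X)"
    by (intro sum.cong refl)
      (simp add: doubled_coprod_upper_set_elem[OF te] tensor_sum tensor_assoc_tensor
        linear_pm_sum[OF algebra_homD(1)[OF algebra_hom_tensor_assoc]])
  also have "\<dots> = (\<Sum>(W, X)\<in>(SIGMA W:?A. {X \<in> upper_sets t. X \<subseteq> W}). ?f W X)"
    using finite_upper_sets[OF te] by (intro sum.Sigma) auto
  also have "\<dots> = (\<Sum>(X, Y)\<in>(SIGMA X:?A. ?B X). ?f (X \<union> Y) X)"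
  proof (rule sum.reindex_bij_witness[where i = "\<lambda>(X, Y). (X \<union> Y, X)" and j = "\<lambda>(W, X). (X, W - X)"])
    fix p assume "p \<in> (SIGMA W:?A. {X \<in> upper_sets t. X \<subseteq> W})"
    then obtain W X where p: "p = (W, X)" "W \<in> upper_sets t" "W \<subseteq> U" "X \<in> upper_sets t" "X \<subseteq> W"
      by auto
    then have u: "X \<union> (W - X) = W" by auto
    have "W - X \<in> ?B X" using upB[OF p(4)] p u by auto
    then show "(case p of (W, X) \<Rightarrow> (X, W - X)) \<in> (SIGMA X:?A. ?B X)"
      using p by auto
    show "(case (case p of (W, X) \<Rightarrow> (X, W - X)) of (X, Y) \<Rightarrow> (X \<union> Y, X)) = p"
      "(case (case p of (W, X) \<Rightarrow> (X, W - X)) of (X, Y) \<Rightarrow> ?f (X \<union> Y) X) = (case p of (W, X) \<Rightarrow> ?f W X)"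
      using p u by auto
  next
    fix p assume "p \<in> (SIGMA X:?A. ?B X)"
    then obtain X Y where p: "p = (X, Y)" "X \<in> upper_sets t" "X \<subseteq> U" "Y \<in> ?B X"
      by auto
    then have Y: "Y \<subseteq> U - X" "X \<union> Y \<in> upper_sets t" using upB by blast+
    then have u: "(X \<union> Y) - X = Y" by auto
    show "(case (case p of (X, Y) \<Rightarrow> (X \<union> Y, X)) of (W, X) \<Rightarrow> (X, W - X)) = p"
      "(case p of (X, Y) \<Rightarrow> (X \<union> Y, X)) \<in> (SIGMA W:?A. {X \<in> upper_sets t. X \<subseteq> W})"
      using p Y u by auto
  qed
  also have "\<dots> = (\<Sum>X\<in>?A. \<Sum>Y\<in>?B X. ?f (X \<union> Y) X)"
    using fin finB by (intro sum.Sigma[symmetric]) auto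
  also have "\<dots> = (\<Sum>X\<in>?A. tensor (upper_set_elem t X) (doubled_coprod (upper_set_elem (remove_verts t X) (U - X))))"
  proof (intro sum.cong refl)
    fix X assume "X \<in> ?A"
    then have X: "X \<in> upper_sets t" "X \<subseteq> U" by auto
    have UX: "U - X \<in> upper_sets (remove_verts t X)"
      using U X(1) by (rule upper_set_Diff_trunk)
    have "?f (X \<union> Y) X = tensor (upper_set_elem t X) (tensor (upper_set_elem (remove_verts t X) Y)
        (upper_set_elem (remove_verts (remove_verts t X) Y) (U - X - Y)))" if "Y \<in> ?B X" for Y
    proof -
      have "Y \<subseteq> U - X" using that by simp
      then have "(X \<union> Y) - X = Y" "U - (X \<union> Y) = U - X - Y" "pverts t - (X \<union> Y) = pverts t - X - Y"
        by auto
      then show ?thesis by (simp add: Diff_mono)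
    qed
    then have "(\<Sum>Y\<in>?B X. ?f (X \<union> Y) X) =
        (\<Sum>Y\<in>?B X. tensor (upper_set_elem t X) (tensor (upper_set_elem (remove_verts t X) Y)
          (upper_set_elem (remove_verts (remove_verts t X) Y) (U - X - Y))))"
      by (rule sum.cong[OF refl])
    also have "\<dots> = tensor (upper_set_elem t X) (doubled_coprod (upper_set_elem (remove_verts t X) (U - X)))"
      by (simp add: doubled_coprod_upper_set_elem[OF tree_or_empty_remove_verts[OF te X(1)] UX] tensor_sum)
    finally show "(\<Sum>Y\<in>?B X. ?f (X \<union> Y) X) =
        tensor (upper_set_elem t X) (doubled_coprod (upper_set_elem (remove_verts t X) (U - X)))" .
  qed
  also have "\<dots> = tensor_map id doubled_coprod (doubled_coprod (upper_set_elem t U))"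
    by (simp add: doubled_coprod_upper_set_elem[OF te U] tensor_map_tensor[OF linear_id_pm lin]
        linear_pm_sum[OF algebra_homD(1)[OF algebra_hom_tensor_map[OF algebra_hom_id hom]]])
  finally show "tensor_assoc (tensor_map doubled_coprod id (doubled_coprod (Poly_Mapping.single {#x#} 1 :: 'k doubled))) =
      tensor_map id doubled_coprod (doubled_coprod (Poly_Mapping.single {#x#} 1))"
    unfolding x .
qed

lemma doubled_counit_single:
  "doubled_counit (Poly_Mapping.single M c :: 'k::field doubled) =
     c * (\<Prod>x\<in>#M. forest_counit (snd (rep_couple x)))"
  by (simp add: doubled_counit_def lin_ext_single[OF vector_space_mult])

lemma linear_doubled_counit:
  "Vector_Spaces.linear pm_scale (*) (doubled_counit :: 'k::field doubled \<Rightarrow> 'k)"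
  unfolding Vector_Spaces.linear_iff
proof (intro conjI allI vector_space_pm_scale vector_space_mult)
  show add: "doubled_counit (x + y) = doubled_counit x + doubled_counit y" for x y :: "'k doubled"
    unfolding doubled_counit_def by (rule lin_ext_add[OF vector_space_mult])
  show "doubled_counit (pm_scale c x) = c * doubled_counit x" for c and x :: "'k doubled"
    by (induction x rule: pm_induct) (simp_all add: pm_scale_add add doubled_counit_single distrib_left)
qed

lemma doubled_counit_mult: "doubled_counit (x * y) = doubled_counit x * doubled_counit (y :: 'k::field doubled)"
  unfolding doubled_counit_def by (rule lin_ext_mult[OF vector_space_mult]) simp_all

lemma doubled_counit_one: "doubled_counit (1 :: 'k::field doubled) = 1"
  using doubled_counit_single[of 0 1] by simp

lemma doubled_counit_couple_elem:
  assumes "is_couple (t, s)"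
  shows "doubled_counit (couple_elem t s :: 'k::field doubled) = forest_counit s"
proof -
  have "pverts t \<noteq> {}" using assms by (auto simp: is_couple_iff dest: rooted_tree_nonempty)
  moreover obtain t' s' where r: "rep_couple (abs_couple (t, s)) = (t', s')"
    by (cases "rep_couple (abs_couple (t, s))")
  then have "(forest_counit s' :: 'k) = forest_counit s"
    using rep_couple_iso[OF assms] by (auto simp: couple_iso_iff forest_counit_def)
  ultimately show ?thesis
    by (simp add: couple_elem_def doubled_counit_single r)
qed

lemma doubled_counit_upper_set_elem:
  assumes "tree_or_empty t" "U \<in> upper_sets t"
  shows "doubled_counit (upper_set_elem t U :: 'k::field doubled) = (if U = {} then 1 else 0)"
proof (cases "pverts t = {}")
  case True
  then show ?thesis
    using upper_setsD(1)[OF assms(2)] by (simp add: upper_set_elem_def couple_elem_def doubled_counit_one)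
next
  case False
  then have "is_couple (t, pair_induce t U)"
    using assms by (auto simp: tree_or_empty_def is_couple_iff)
  then show ?thesis
    by (simp add: upper_set_elem_def doubled_counit_couple_elem forest_counit_def)
qed

text \<open>
  The counit vanishes on \<open>(t, t[W])\<close> unless \<open>W = {}\<close> and on \<open>(t[V - W], t[U - W])\<close> unless \<open>W = U\<close>, so each
  sum reduces to one term. For \<open>W = U = V\<close> the second factor is the unit.
\<close>

lemma doubled_counit_laws:
  "tensor_lift (\<lambda>y z. pm_scale (doubled_counit y) z) (doubled_coprod x) = (x :: 'k::field doubled)" (is ?left)
  "tensor_lift (\<lambda>y z. pm_scale (doubled_counit z) y) (doubled_coprod x) = x" (is ?right)
proof -
  let ?l = "tensor_lift (\<lambda>y z. pm_scale (doubled_counit y) z) :: 'k doubled2 \<Rightarrow> 'k doubled"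
  let ?r = "tensor_lift (\<lambda>y z. pm_scale (doubled_counit z) y) :: 'k doubled2 \<Rightarrow> 'k doubled"
  note hom = algebra_hom_doubled_coprod[where 'k = 'k]
  have add: "doubled_counit (u + v) = doubled_counit u + doubled_counit v"
    and scale: "doubled_counit (pm_scale c u) = c * doubled_counit u" for u v :: "'k doubled" and c
    using linear_doubled_counit unfolding Vector_Spaces.linear_iff by blast+
  have scale_add: "pm_scale (c + d) u = pm_scale c u + pm_scale d u" for c d and u :: "'k doubled"
    by (auto intro!: poly_mapping_eqI simp: lookup_add distrib_right)
  have pm_scale_zero: "pm_scale 0 u = 0" for u :: "'k doubled"
    by (rule poly_mapping_eqI) simp
  have bil: "bilinear_pm (\<lambda>(y :: 'k doubled) (z :: 'k doubled). pm_scale (doubled_counit y) z)"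
    "bilinear_pm (\<lambda>(y :: 'k doubled) (z :: 'k doubled). pm_scale (doubled_counit z) y)"
    by (simp_all add: bilinear_pm_def Vector_Spaces.linear_iff vector_space_pm_scale add scale
        pm_scale_add pm_scale_pm_scale scale_add mult.commute)
  have homl: "algebra_hom ?l" and homr: "algebra_hom ?r"
    by (rule algebra_hom_tensor_lift; simp add: doubled_counit_mult doubled_counit_one pm_scale_one pm_scale_mult)+
  have gen: "?l (doubled_coprod (Poly_Mapping.single {#y#} 1)) = Poly_Mapping.single {#y#} 1 \<and>
     ?r (doubled_coprod (Poly_Mapping.single {#y#} 1)) = Poly_Mapping.single {#y#} 1" for y
  proof -
    obtain t U where t: "rooted_tree t" and U: "U \<in> upper_sets t"
      and y: "Poly_Mapping.single {#y#} 1 = (upper_set_elem t U :: 'k doubled)"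
      by (rule generator_upper_set_elem)
    have te: "tree_or_empty t" using t by (simp add: tree_or_empty_def)
    note wf = tree_or_empty_wf[OF te]
    let ?A = "{W \<in> upper_sets t. W \<subseteq> U}"
    have fin: "finite ?A" using finite_upper_sets[OF te] by simp
    have rem: "remove_verts t {} = t"
      using wf by (cases t) (auto simp: pair_induce_def)
    then have rem': "pair_induce t (pverts t) = t" by simp
    have UW: "U - W \<in> upper_sets (remove_verts t W)" if "W \<in> ?A" for W
      using that upper_set_Diff_trunk[OF U] by blast
    have "?l (doubled_coprod (upper_set_elem t U)) =
        (\<Sum>W\<in>?A. if W = {} then upper_set_elem (remove_verts t W) (U - W) else 0)"
      by (simp add: doubled_coprod_upper_set_elem[OF te U] linear_pm_sum[OF linear_tensor_lift]
          tensor_lift_tensor[OF bil(1)] doubled_counit_upper_set_elem[OF te])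
        (rule sum.cong, simp_all add: pm_scale_one pm_scale_zero)
    also have "\<dots> = upper_set_elem t U"
      using fin by (simp add: rem')
    finally have l: "?l (doubled_coprod (upper_set_elem t U)) = upper_set_elem t U" .
    have "?r (doubled_coprod (upper_set_elem t U)) =
        (\<Sum>W\<in>?A. pm_scale (doubled_counit (upper_set_elem (remove_verts t W) (U - W) :: 'k doubled)) (upper_set_elem t W))"
      by (simp add: doubled_coprod_upper_set_elem[OF te U] linear_pm_sum[OF linear_tensor_lift]
          tensor_lift_tensor[OF bil(2)])
    also have "\<dots> = (\<Sum>W\<in>?A. if W = U then upper_set_elem t W else 0)"
    proof (intro sum.cong refl)
      fix W assume W: "W \<in> ?A"
      then have "U - W = {} \<longleftrightarrow> W = U" by auto
      then have "doubled_counit (upper_set_elem (remove_verts t W) (U - W) :: 'k doubled) = (if W = U then 1 else 0)"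
        using doubled_counit_upper_set_elem[OF tree_or_empty_remove_verts[OF te] UW[OF W], where 'k = 'k] W
        by simp
      then show "pm_scale (doubled_counit (upper_set_elem (remove_verts t W) (U - W) :: 'k doubled)) (upper_set_elem t W) =
          (if W = U then upper_set_elem t W else 0)"
        by (simp add: pm_scale_one pm_scale_zero)
    qed
    also have "\<dots> = upper_set_elem t U"
      using fin U by simp
    finally show ?thesis using l by (simp add: y)
  qed
  show ?left
    using algebra_hom_eq[OF algebra_hom_comp[OF hom homl] algebra_hom_id, of x] gen by simp
  show ?right
    using algebra_hom_eq[OF algebra_hom_comp[OF hom homr] algebra_hom_id, of x] gen by simp
qed

section \<open>The grading\<close>

definition monomial_degree :: "couple multiset \<Rightarrow> nat" where
  "monomial_degree M = (\<Sum>y\<in>#M. couple_degree y)"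

lemma monomial_degree_simps [simp]:
  "monomial_degree 0 = 0" "monomial_degree {#} = 0" "monomial_degree (M + N) = monomial_degree M + monomial_degree N"
  "monomial_degree {#x#} = couple_degree x"
  by (simp_all add: monomial_degree_def)

lemma doubled_homog_iff: "x \<in> doubled_homog n \<longleftrightarrow> (\<forall>M\<in>Poly_Mapping.keys x. monomial_degree M = n)"
  by (simp add: doubled_homog_def monomial_degree_def)

lemma couple_degree_abs:
  assumes "is_couple (t, s)"
  shows "couple_degree (abs_couple (t, s)) = card (pverts s)"
proof -
  obtain t' s' where r: "rep_couple (abs_couple (t, s)) = (t', s')"
    by (cases "rep_couple (abs_couple (t, s))")
  then have "couple_iso (t, s) (t', s')"
    using rep_couple_iso[OF assms] couple_iso_sym by simp
  then obtain f where "inj_on f (pverts t)" "pverts s' = f ` pverts s"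
    by (auto simp: couple_iso_iff)
  moreover from this have "inj_on f (pverts s)"
    using is_couple_subset(1)[OF assms] by (blast intro: inj_on_subset)
  ultimately show ?thesis by (simp add: couple_degree_def r card_image)
qed

lemma couple_elem_homog:
  assumes "is_couple (t, s)"
  shows "(couple_elem t s :: 'k::field doubled) \<in> doubled_homog (card (pverts s))"
  using couple_degree_abs[OF assms] is_couple_subset(1)[OF assms]
  by (auto simp: couple_elem_def doubled_homog_iff keys_one)

lemma upper_set_elem_homog:
  assumes "tree_or_empty t" "U \<in> upper_sets t"
  shows "(upper_set_elem t U :: 'k::field doubled) \<in> doubled_homog (card U)"
proof (cases "pverts t = {}")
  case True
  then show ?thesis
    using upper_setsD(1)[OF assms(2)] by (simp add: upper_set_elem_def couple_elem_def doubled_homog_iff keys_one)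
next
  case False
  then have "is_couple (t, pair_induce t U)"
    using assms by (auto simp: tree_or_empty_def is_couple_iff)
  then show ?thesis
    using couple_elem_homog by (fastforce simp: upper_set_elem_def)
qed

text \<open>
  The homogeneous elements of the tensor square, described by their coefficients; \<open>bihomog_span\<close>
  relates them to tensors of homogeneous elements.
\<close>

definition bihomog :: "nat \<Rightarrow> 'k::field doubled2 set" where
  "bihomog n = {u. \<forall>(M, N)\<in>Poly_Mapping.keys u. monomial_degree M + monomial_degree N = n}"

lemma bihomog_iff: "u \<in> bihomog n \<longleftrightarrow>
    (\<forall>M N. Poly_Mapping.lookup u (M, N) \<noteq> 0 \<longrightarrow> monomial_degree M + monomial_degree N = n)"
  by (auto simp: bihomog_def in_keys_iff)

lemma bihomog_sum: "(\<And>i. i \<in> A \<Longrightarrow> f i \<in> bihomog n) \<Longrightarrow> sum f A \<in> bihomog n"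
  unfolding bihomog_iff lookup_sum by (metis (no_types, lifting) sum.neutral)

lemma bihomog_tensor: "x \<in> doubled_homog m \<Longrightarrow> y \<in> doubled_homog n \<Longrightarrow> tensor x y \<in> bihomog (m + n)"
  by (auto simp: bihomog_iff doubled_homog_iff in_keys_iff)

lemma bihomog_mult: "u \<in> bihomog m \<Longrightarrow> v \<in> bihomog n \<Longrightarrow> u * v \<in> bihomog (m + n)"
  using keys_mult[of u v] unfolding bihomog_def by fastforce

text \<open>
  For a single couple this is \<open>|W| + |U - W| = |U|\<close>; products add the degrees.
\<close>

lemma doubled_coprod_monomial_bihomog:
  "doubled_coprod (Poly_Mapping.single M 1 :: 'k::field doubled) \<in> bihomog (monomial_degree M)"
proof (induction M)
  case empty
  have "doubled_coprod (Poly_Mapping.single {#} 1 :: 'k doubled) = 1"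
    using doubled_coprod_single[of "{#}" 1] by (simp add: pm_scale_one)
  then show ?case by (simp add: bihomog_def keys_one zero_prod_def)
next
  case (add x M)
  obtain t U where t: "rooted_tree t" and U: "U \<in> upper_sets t"
    and x: "Poly_Mapping.single {#x#} 1 = (upper_set_elem t U :: 'k doubled)"
    by (rule generator_upper_set_elem)
  have te: "tree_or_empty t" using t by (simp add: tree_or_empty_def)
  note Usub = upper_setsD(1)[OF U]
  have finU: "finite U" using Usub tree_or_empty_finite[OF te] by (rule finite_subset)
  have "(Poly_Mapping.single {#x#} 1 :: 'k doubled) \<in> doubled_homog (card U)"
    unfolding x using te U by (rule upper_set_elem_homog)
  then have deg: "couple_degree x = card U" by (simp add: doubled_homog_iff)
  have "tensor (upper_set_elem t W :: 'k doubled) (upper_set_elem (remove_verts t W) (U - W)) \<in> bihomog (card U)"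
    if W: "W \<in> upper_sets t" "W \<subseteq> U" for W
  proof -
    have "U - W \<in> upper_sets (remove_verts t W)"
      using U W(1) by (rule upper_set_Diff_trunk)
    moreover have "card W + card (U - W) = card U"
      using card_Diff_subset[OF finite_subset[OF W(2) finU] W(2)] card_mono[OF finU W(2)] by simp
    ultimately show ?thesis
      using bihomog_tensor[OF upper_set_elem_homog[OF te W(1)]
          upper_set_elem_homog[OF tree_or_empty_remove_verts[OF te W(1)]]] by metis
  qed
  then have "doubled_coprod (Poly_Mapping.single {#x#} 1 :: 'k doubled) \<in> bihomog (monomial_degree {#x#})"
    unfolding x doubled_coprod_upper_set_elem[OF te U] monomial_degree_simps deg by (intro bihomog_sum) auto
  from bihomog_mult[OF this add]
  have "doubled_coprod (Poly_Mapping.single {#x#} 1 * Poly_Mapping.single M 1 :: 'k doubled)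
      \<in> bihomog (monomial_degree ({#x#} + M))"
    unfolding algebra_homD(3)[OF algebra_hom_doubled_coprod] monomial_degree_simps .
  then show ?case by (simp add: mult_single)
qed

lemma doubled_coprod_bihomog:
  assumes "x \<in> doubled_homog n"
  shows "doubled_coprod (x :: 'k::field doubled) \<in> bihomog n"
proof -
  note lin = algebra_homD(1)[OF algebra_hom_doubled_coprod[where 'k = 'k]]
  have "doubled_coprod x = (\<Sum>M\<in>Poly_Mapping.keys x.
      pm_scale (Poly_Mapping.lookup x M) (doubled_coprod (Poly_Mapping.single M 1)))"
    by (subst sum_scaled_basis[of x, symmetric]) (simp only: linear_pm_sum[OF lin] linear_pm_scale[OF lin])
  moreover have "pm_scale c (doubled_coprod (Poly_Mapping.single M 1 :: 'k doubled)) \<in> bihomog n"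
    if "M \<in> Poly_Mapping.keys x" for c M
    using doubled_coprod_monomial_bihomog[of M] assms that by (auto simp: bihomog_iff doubled_homog_iff)
  ultimately show ?thesis by (auto intro!: bihomog_sum)
qed

lemma bihomog_span:
  assumes "u \<in> bihomog n"
  shows "u \<in> module.span pm_scale {tensor y z | y z. \<exists>p q. p + q = n \<and> y \<in> doubled_homog p \<and> z \<in> doubled_homog q}"
    (is "_ \<in> module.span _ ?S")
proof -
  interpret vector_space "pm_scale :: 'a \<Rightarrow> 'a doubled2 \<Rightarrow> _" by (rule vector_space_pm_scale)
  have "(\<Sum>i\<in>Poly_Mapping.keys u. pm_scale (Poly_Mapping.lookup u i) (Poly_Mapping.single i 1)) \<in> span ?S"
  proof (intro span_sum span_scale span_base)
    fix p assume p: "p \<in> Poly_Mapping.keys u"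
    obtain M N where MN: "p = (M, N)" by (cases p)
    have "monomial_degree M + monomial_degree N = n"
      using assms p MN by (auto simp: bihomog_def)
    moreover have "Poly_Mapping.single p (1 :: 'a) = tensor (Poly_Mapping.single M 1) (Poly_Mapping.single N 1)"
      by (simp add: MN tensor_single)
    moreover have "Poly_Mapping.single M 1 \<in> doubled_homog (monomial_degree M)" for M
      by (simp add: doubled_homog_iff)
    ultimately show "Poly_Mapping.single p 1 \<in> ?S" by blast
  qed
  then show ?thesis by (simp only: sum_scaled_basis)
qed

text \<open>
  The component of degree \<open>n\<close> is the part of \<open>x\<close> supported on the monomials of degree \<open>n\<close>. It is the
  only choice because the coefficient of a monomial in a sum of homogeneous elements comes from the
  summand of its own degree.
\<close>

lemma doubled_direct_sum:
  fixes x :: "'k::field doubled"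
  shows "\<exists>!f. (\<forall>n. f n \<in> doubled_homog n) \<and> finite {n. f n \<noteq> 0} \<and> x = (\<Sum>n | f n \<noteq> 0. f n)"
proof -
  have lookup_sum_homog: "Poly_Mapping.lookup (\<Sum>n | f n \<noteq> 0. f n) M = Poly_Mapping.lookup (f (monomial_degree M)) M"
    if f: "\<forall>n. f n \<in> doubled_homog n" "finite {n. f n \<noteq> 0}" for f :: "nat \<Rightarrow> 'k doubled" and M
  proof -
    have "Poly_Mapping.lookup (f n) M = (if n = monomial_degree M then Poly_Mapping.lookup (f (monomial_degree M)) M else 0)" for n
    proof (cases "n = monomial_degree M")
      case False
      then have "M \<notin> Poly_Mapping.keys (f n)" using f(1) by (auto simp: doubled_homog_iff)
      then show ?thesis using False by (simp add: in_keys_iff)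
    qed simp
    then have "Poly_Mapping.lookup (\<Sum>n | f n \<noteq> 0. f n) M =
        (\<Sum>n | f n \<noteq> 0. if n = monomial_degree M then Poly_Mapping.lookup (f (monomial_degree M)) M else 0)"
      unfolding lookup_sum by (intro sum.cong refl)
    also have "\<dots> = Poly_Mapping.lookup (f (monomial_degree M)) M"
      using f(2) by auto
    finally show ?thesis .
  qed
  define f where "f n = (\<Sum>M | M \<in> Poly_Mapping.keys x \<and> monomial_degree M = n.
      Poly_Mapping.single M (Poly_Mapping.lookup x M))" for n
  have look: "Poly_Mapping.lookup (f n) M = (if monomial_degree M = n then Poly_Mapping.lookup x M else 0)" for n M
  proof -
    have "Poly_Mapping.lookup (f n) M = (\<Sum>N | N \<in> Poly_Mapping.keys x \<and> monomial_degree N = n.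
        if N = M then Poly_Mapping.lookup x N else 0)"
      unfolding f_def lookup_sum by (intro sum.cong refl) (simp add: lookup_single when_def)
    then show ?thesis by (auto simp: in_keys_iff)
  qed
  have f: "\<forall>n. f n \<in> doubled_homog n"
    by (auto simp: doubled_homog_iff in_keys_iff look split: if_splits)
  have "{n. f n \<noteq> 0} \<subseteq> monomial_degree ` Poly_Mapping.keys x"
  proof
    fix n assume "n \<in> {n. f n \<noteq> 0}"
    then obtain M where "Poly_Mapping.lookup (f n) M \<noteq> 0"
      by (auto simp: poly_mapping_eq_iff fun_eq_iff)
    then show "n \<in> monomial_degree ` Poly_Mapping.keys x"
      by (auto simp: look in_keys_iff split: if_splits)
  qed
  then have fin: "finite {n. f n \<noteq> 0}" by (rule finite_subset) simp
  have "x = (\<Sum>n | f n \<noteq> 0. f n)"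
    by (rule poly_mapping_eqI) (simp add: lookup_sum_homog[OF f fin] look)
  moreover have "g = f" if g: "\<forall>n. g n \<in> doubled_homog n" "finite {n. g n \<noteq> 0}" "x = (\<Sum>n | g n \<noteq> 0. g n)" for g
  proof (intro ext poly_mapping_eqI)
    fix n M
    have "Poly_Mapping.lookup x M = Poly_Mapping.lookup (g (monomial_degree M)) M"
      using lookup_sum_homog[OF g(1,2)] g(3) by metis
    then show "Poly_Mapping.lookup (g n) M = Poly_Mapping.lookup (f n) M"
      using g(1) by (cases "n = monomial_degree M")
        (auto simp: look doubled_homog_iff simp flip: not_in_keys_iff_lookup_eq_zero)
  qed
  ultimately show ?thesis using f fin by blast
qed

text \<open>
  A monomial of positive degree has a factor whose pruning is nonempty, and there the counit vanishes.
\<close>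

lemma doubled_counit_homog:
  assumes "x \<in> doubled_homog n" "n \<noteq> 0"
  shows "doubled_counit (x :: 'k::field doubled) = 0"
  unfolding doubled_counit_def lin_ext_def
proof (rule sum.neutral, rule ballI)
  fix M assume "M \<in> Poly_Mapping.keys x"
  then have "monomial_degree M \<noteq> 0" using assms by (simp add: doubled_homog_iff)
  then obtain y where y: "y \<in># M" "couple_degree y \<noteq> 0"
    by (auto simp: monomial_degree_def)
  then have "(forest_counit (snd (rep_couple y)) :: 'k) = 0"
    by (auto simp: couple_degree_def forest_counit_def)
  then have "(0 :: 'k) \<in># image_mset (\<lambda>x. forest_counit (snd (rep_couple x))) M"
    using y(1) by (auto intro!: image_eqI[of _ _ y])
  then have "(\<Prod>x\<in>#M. forest_counit (snd (rep_couple x)) :: 'k) = 0"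
    by (simp only: prod_mset_zero_iff)
  then show "Poly_Mapping.lookup x M * (\<Prod>x\<in>#M. forest_counit (snd (rep_couple x))) = 0" by simp
qed

lemma doubled_graded_bialgebra:
  "graded_bialgebra ((*) :: 'k::field doubled \<Rightarrow> 'k doubled \<Rightarrow> 'k doubled) 1
      doubled_coprod doubled_counit doubled_homog"
proof (intro graded_bialgebra.intro bialgebra.intro graded_bialgebra_axioms.intro)
  note hom = algebra_hom_doubled_coprod[where 'k = 'k]
  have "x * pm_scale c y = pm_scale c (x * y)" "pm_scale c x * y = pm_scale c (x * y)" for c and x y :: "'k doubled"
    using pm_scale_mult[of 1 c x y] pm_scale_mult[of c 1 x y] by (simp_all add: pm_scale_one)
  then show "bilinear_pm ((*) :: 'k doubled \<Rightarrow> _)"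
    by (simp add: bilinear_pm_def Vector_Spaces.linear_iff vector_space_pm_scale distrib_left distrib_right)
  show "Vector_Spaces.linear pm_scale pm_scale (doubled_coprod :: 'k doubled \<Rightarrow> _)"
    by (rule algebra_homD(1)[OF hom])
  show "Vector_Spaces.linear pm_scale (*) (doubled_counit :: 'k doubled \<Rightarrow> _)"
    by (rule linear_doubled_counit)
  show "doubled_coprod (1 :: 'k doubled) = tensor 1 1"
    using algebra_homD(2)[OF hom] by (simp add: one_tensor)
  fix x y z :: "'k doubled" and m n :: nat
  show "doubled_coprod (x * y) = tensor_mul (*) (doubled_coprod x) (doubled_coprod y)"
    by (simp add: tensor_mul_mult algebra_homD(3)[OF hom])
  show "module.subspace pm_scale (doubled_homog n :: 'k doubled set)"
  proof -
    interpret vector_space "pm_scale :: 'k \<Rightarrow> 'k doubled \<Rightarrow> _" by (rule vector_space_pm_scale)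
    have "Poly_Mapping.keys (pm_scale c u) \<subseteq> Poly_Mapping.keys u" for c and u :: "'k doubled"
      by (auto simp: in_keys_iff)
    moreover have "Poly_Mapping.keys (u + v) \<subseteq> Poly_Mapping.keys u \<union> Poly_Mapping.keys v" for u v :: "'k doubled"
      by (rule keys_add)
    ultimately show ?thesis
      by (intro subspaceI; unfold doubled_homog_iff) (simp, blast+)
  qed
  show "x * y \<in> doubled_homog (m + n)" if "x \<in> doubled_homog m" "y \<in> doubled_homog n"
    unfolding doubled_homog_iff
  proof
    fix M assume "M \<in> Poly_Mapping.keys (x * y)"
    then obtain A B where "M = A + B" "A \<in> Poly_Mapping.keys x" "B \<in> Poly_Mapping.keys y"
      using keys_mult[of x y] by blast
    then show "monomial_degree M = m + n" using that by (simp add: doubled_homog_iff)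
  qed
  show "doubled_coprod x \<in> module.span pm_scale
      {tensor y z | y z. \<exists>p q. p + q = n \<and> y \<in> doubled_homog p \<and> z \<in> doubled_homog q}" if "x \<in> doubled_homog n"
    using doubled_coprod_bihomog[OF that] by (rule bihomog_span)
  show "\<exists>!f. (\<forall>n. f n \<in> doubled_homog n) \<and> finite {n. f n \<noteq> 0} \<and> x = (\<Sum>n | f n \<noteq> 0. f n)"
    by (rule doubled_direct_sum)
  show "doubled_counit x = 0" if "x \<in> doubled_homog n" "n \<noteq> 0"
    using that by (rule doubled_counit_homog)
qed (auto simp: mult.assoc doubled_coassoc doubled_counit_laws doubled_counit_mult doubled_counit_one
    doubled_homog_iff keys_one)

theorem theorem1:
  shows "(\<forall>t s. is_couple (t, s) \<longrightarrow>
      doubled_coprod (couple_elem t s :: 'k::field doubled) =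
        (\<Sum>c\<in>Adm s. tensor (couple_elem t (pruning s c))
                             (couple_elem (ambient_trunk t s c) (trunk s c))) \<and>
      doubled_counit (couple_elem t s :: 'k doubled) = forest_counit s \<and>
      (couple_elem t s :: 'k doubled) \<in> doubled_homog (card (pverts s))) \<and>
    graded_bialgebra ((*) :: 'k doubled \<Rightarrow> 'k doubled \<Rightarrow> 'k doubled) 1
      doubled_coprod doubled_counit doubled_homog"
  using doubled_coprod_couple_elem doubled_counit_couple_elem couple_elem_homog doubled_graded_bialgebra
  unfolding couple_coprod_def by blast

end
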